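(* Let $1\le p\le q<\infty$, $\alpha>-1$ and $0\le\gamma<2+\alpha$. Let $\omega$ be a weight and $\mu$ a positive Borel measure on $\mathcal H$. The following are equivalent: (a) there is $C_1>0$ such that for every $f\in L^p(\mathcal H,\omega\,dV_\alpha)$ and every $\lambda>0$, $$\mu(\{z\in\mathcal H:\mathcal M_{\alpha,\gamma}f(z)>\lambda\})\le\frac{C_1}{\lambda^q}\left(\int_{\mathcal H}|f|^p\omega\,dV_\alpha\right)^{q/p};$$ (b) there is $C_2>0$ such that for every interval $I\subset\mathbb R$, $$|Q_I|_\alpha^{q(\frac{\gamma}{2+\alpha}-\frac1p)}\left(\frac1{|Q_I|_\alpha}\int_{Q_I}\omega^{1-p'}\,dV_\alpha\right)^{q/p'}\mu(Q_I)\le C_2,$$ where for $p=1$ the factor $\left(\frac1{|Q_I|_\alpha}\int_{Q_I}\omega^{1-p'}dV_\alpha\right)^{1/p'}$ is understood as $(\inf_{Q_I}\omega)^{-1}$; (c) there is $C_3>0$ such that for every locally integrable $f$ and every interval $I\subset\mathbb R$, $$\left(\frac{1}{|Q_I|_\alpha^{1-\frac{\gamma}{2+\alpha}}}\int_{Q_I}|f|\,dV_\alpha\right)^q\mu(Q_I)\le C_3\left(\int_{Q_I}|f|^p\omega\,dV_\alpha\right)^{q/p}.$$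
   Context: $\mathcal H=\{x+iy:x\in\mathbb R,\ y>0\}$; for $\alpha>-1$, $dV_\alpha(x+iy)=y^\alpha dx\,dy$. A weight is a nonnegative locally integrable function on $\mathcal H$; $L^p(\mathcal H,\omega dV_\alpha)$ is the space of $f$ with $\int_{\mathcal H}|f|^p\omega\,dV_\alpha<\infty$. $p'$ is the conjugate exponent of $p$. For an interval $I\subset\mathbb R$, $Q_I=\{x+iy:x\in I,\ 0<y<|I|\}$ and $|Q_I|_\alpha=\int_{Q_I}dV_\alpha$. For $0\le\gamma<2+\alpha$ and locally integrable $f$, $\mathcal M_{\alpha,\gamma}f(z)=\sup\{|I|^{-(2+\alpha-\gamma)}\int_{Q_I}|f|\,dV_\alpha:\ I\subset\mathbb R\text{ an interval with } z\in Q_I\}$.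
   Formalization: For p=1, the infimum of ω over Q_I in (b) is taken as the essential infimum with respect to dV_α; with the pointwise infimum the equivalence fails, e.g. for ω=1 except ω=0 on a countable dense set and μ Lebesgue measure. *)

theory Defs
  imports "HOL-Analysis.Analysis"
begin

definition UHP :: "complex set" where
  "UHP = {z. Im z > 0}"

definition dV :: "real \<Rightarrow> complex measure" where
  "dV \<alpha> = density lborel (\<lambda>z. indicator UHP z * ennreal (Im z powr \<alpha>))"

text \<open>Bounded intervals of positive length (open, closed or half-open).\<close>
definition intervals :: "real set set" where
  "intervals = {I. \<exists>a b. a < b \<and> {a<..<b} \<subseteq> I \<and> I \<subseteq> {a..b}}"

definition ilen :: "real set \<Rightarrow> real" where
  "ilen I = Sup I - Inf I"

definition Qbox :: "real set \<Rightarrow> complex set" where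
  "Qbox I = {z. Re z \<in> I \<and> 0 < Im z \<and> Im z < ilen I}"

definition Qvol :: "real \<Rightarrow> real set \<Rightarrow> real" where
  "Qvol \<alpha> I = measure (dV \<alpha>) (Qbox I)"

definition loc_int :: "(complex \<Rightarrow> real) \<Rightarrow> bool" where
  "loc_int f \<longleftrightarrow> f \<in> borel_measurable borel \<and>
     (\<forall>K. compact K \<and> K \<subseteq> UHP \<longrightarrow> (\<integral>\<^sup>+ z. ennreal \<bar>f z\<bar> * indicator K z \<partial>lborel) < \<infinity>)"

definition weight :: "(complex \<Rightarrow> real) \<Rightarrow> bool" where
  "weight \<omega> \<longleftrightarrow> (\<forall>z\<in>UHP. 0 \<le> \<omega> z) \<and> loc_int \<omega>"

definition Mfrac :: "real \<Rightarrow> real \<Rightarrow> (complex \<Rightarrow> real) \<Rightarrow> complex \<Rightarrow> ennreal" where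
  "Mfrac \<alpha> \<gamma> f z = (SUP I \<in> {I \<in> intervals. z \<in> Qbox I}.
      ennreal (ilen I powr (-(2 + \<alpha> - \<gamma>))) * (\<integral>\<^sup>+ w\<in>Qbox I. ennreal \<bar>f w\<bar> \<partial>dV \<alpha>))"

text \<open>Real powers of extended nonnegative reals, for positive exponents (infinity^r = infinity).\<close>
definition epowr :: "ennreal \<Rightarrow> real \<Rightarrow> ennreal" where
  "epowr x r = (if x = top then top else ennreal (enn2real x powr r))"

definition conj_exp :: "real \<Rightarrow> real" where
  "conj_exp p = p / (p - 1)"

text \<open>omega^s for a negative exponent s, with 0^s = infinity.\<close>
definition wpow :: "(complex \<Rightarrow> real) \<Rightarrow> real \<Rightarrow> complex \<Rightarrow> ennreal" where
  "wpow \<omega> s z = (if \<omega> z = 0 then top else ennreal (\<omega> z powr s))"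

definition essinf_on :: "real \<Rightarrow> (complex \<Rightarrow> real) \<Rightarrow> complex set \<Rightarrow> ennreal" where
  "essinf_on \<alpha> \<omega> Q = (SUP c \<in> {c. AE z in dV \<alpha>. z \<in> Q \<longrightarrow> c \<le> ennreal (\<omega> z)}. c)"

text \<open>Left-hand side of condition (b), without the factor mu(Q_I).\<close>
definition bfactor :: "real \<Rightarrow> real \<Rightarrow> real \<Rightarrow> real \<Rightarrow> (complex \<Rightarrow> real) \<Rightarrow> real set \<Rightarrow> ennreal" where
  "bfactor p q \<alpha> \<gamma> \<omega> I =
     ennreal (Qvol \<alpha> I powr (q * (\<gamma> / (2 + \<alpha>) - 1 / p))) *
     (if p = 1 then epowr (inverse (essinf_on \<alpha> \<omega> (Qbox I))) q
      else epowr ((\<integral>\<^sup>+ z\<in>Qbox I. wpow \<omega> (1 - conj_exp p) z \<partial>dV \<alpha>) / ennreal (Qvol \<alpha> I))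
                 (q / conj_exp p))"

end

theory Submission
  imports Defs
begin

text \<open>
  Hoelder's inequality turns (b) into the inequality of (c) for all Borel functions \<open>f\<close>, not only
  locally integrable ones; conversely (c) gives (b) by testing on truncations of \<open>\<omega>\<^bsup>1-p'\<^esup>\<close>, or, for
  \<open>p = 1\<close>, on indicators of sets where \<open>\<omega>\<close> is close to its essential infimum.  Testing the weak type
  inequality on \<open>f 1\<^bsub>Q\<^esub>\<close>, whose maximal function on \<open>Q\<close> is at least the average of \<open>f\<close> over \<open>Q\<close>,
  gives (c).

  For the weak type inequality, the superlevel set of the maximal function is an open union of boxes,
  so that by Lindeloef finitely many boxes suffice.  Vitali's covering argument selects
  disjoint boxes whose triples cover; the inequality of (c) for \<open>f 1\<^bsub>Q\<^esub>\<close> on the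
  tripled box bounds the measure of the latter by the integral over \<open>Q\<close>, without any doubling
  hypothesis on \<open>\<mu>\<close>.  The bounds add up because \<open>x \<mapsto> x\<^bsup>q/p\<^esup>\<close> is superadditive for \<open>p \<le> q\<close>.
\<close>

section \<open>Powers on the extended nonnegative reals, and Hoelder's inequality\<close>

lemma epowr_ennreal: "0 \<le> x \<Longrightarrow> epowr (ennreal x) r = ennreal (x powr r)"
  by (simp add: epowr_def)

lemma epowr_top [simp]: "epowr top r = top"
  by (simp add: epowr_def)

lemma epowr_0 [simp]: "epowr 0 r = 0"
  by (simp add: epowr_def)

lemma epowr_eq_0_iff: "0 < r \<Longrightarrow> epowr x r = 0 \<longleftrightarrow> x = 0"
  by (cases x) (auto simp: epowr_def ennreal_eq_0_iff)

lemma epowr_eq_top_iff: "epowr x r = top \<longleftrightarrow> x = top"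
  by (simp add: epowr_def)

lemma epowr_mono: "x \<le> y \<Longrightarrow> 0 \<le> r \<Longrightarrow> epowr x r \<le> epowr y r"
  by (cases x; cases y) (auto simp: epowr_ennreal intro!: ennreal_leI powr_mono2 simp: top_unique)

lemma epowr_epowr: "epowr (epowr x r) s = epowr x (r * s)"
  by (cases x) (auto simp: epowr_ennreal powr_powr)

lemma epowr_1 [simp]: "epowr x 1 = x"
  by (cases x) (auto simp: epowr_ennreal)

lemma epowr_mult: "0 < r \<Longrightarrow> epowr (x * y) r = epowr x r * epowr y r"
  by (cases x; cases y)
     (auto simp: epowr_ennreal powr_mult ennreal_mult[symmetric] ennreal_top_mult ennreal_mult_top
       ennreal_eq_0_iff)

lemma epowr_add: "0 < r \<Longrightarrow> 0 < s \<Longrightarrow> epowr x (r + s) = epowr x r * epowr x s"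
  by (cases x) (auto simp: epowr_ennreal powr_add ennreal_mult[symmetric])

text \<open>For positive \<open>r\<close> the power is an order automorphism whose inverse has
  exponent \<open>1 / r\<close>; in this adjoint form the fact yields compatibility with
  suprema.\<close>

lemma epowr_le_iff:
  assumes "0 < r"
  shows "epowr x r \<le> y \<longleftrightarrow> x \<le> epowr y (1 / r)"
proof
  assume "epowr x r \<le> y"
  then have "epowr (epowr x r) (1 / r) \<le> epowr y (1 / r)"
    using assms by (intro epowr_mono) auto
  then show "x \<le> epowr y (1 / r)" using assms by (simp add: epowr_epowr)
next
  assume "x \<le> epowr y (1 / r)"
  then have "epowr x r \<le> epowr (epowr y (1 / r)) r"
    using assms by (intro epowr_mono) auto
  then show "epowr x r \<le> y" using assms by (simp add: epowr_epowr)
qed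

lemma epowr_SUP:
  assumes "0 < r"
  shows "epowr (SUP i\<in>A. f i) r = (SUP i\<in>A. epowr (f i) r)"
proof (rule antisym)
  show "epowr (SUP i\<in>A. f i) r \<le> (SUP i\<in>A. epowr (f i) r)"
    unfolding epowr_le_iff[OF assms]
    by (rule SUP_least) (auto simp: epowr_le_iff[OF assms, symmetric] intro: SUP_upper)
  show "(SUP i\<in>A. epowr (f i) r) \<le> epowr (SUP i\<in>A. f i) r"
    using assms by (intro SUP_least epowr_mono SUP_upper) auto
qed

text \<open>In \<open>c powr s = c * c powr (s - 1)\<close> the second factor is monotone because
  \<open>1 \<le> s\<close>, so for both summands it may be enlarged to
  \<open>(a + b) powr (s - 1)\<close>.\<close>

lemma epowr_superadditive:
  assumes "1 \<le> s"
  shows "epowr x s + epowr y s \<le> epowr (x + y) s"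
proof -
  have *: "a powr s + b powr s \<le> (a + b) powr s" if "0 \<le> a" "0 \<le> b" for a b :: real
  proof -
    have split: "c powr s = c * c powr (s - 1)" if "0 \<le> c" for c :: real
      using that powr_mult_base[of c "s - 1"] by simp
    have "a * a powr (s - 1) + b * b powr (s - 1)
        \<le> a * (a + b) powr (s - 1) + b * (a + b) powr (s - 1)"
      using that assms by (intro add_mono mult_left_mono powr_mono2) auto
    then show ?thesis
      using that by (simp add: split[of a] split[of b] split[of "a + b"] distrib_right)
  qed
  show ?thesis
    by (cases x; cases y)
       (auto simp: epowr_ennreal ennreal_plus[symmetric] * simp del: ennreal_plus)
qed

lemma epowr_sum_le:
  assumes "1 \<le> s" "finite A"
  shows "(\<Sum>i\<in>A. epowr (f i) s) \<le> epowr (\<Sum>i\<in>A. f i) s"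
  using assms(2)
proof induction
  case (insert a A)
  then have "(\<Sum>i\<in>insert a A. epowr (f i) s) \<le> epowr (f a) s + epowr (\<Sum>i\<in>A. f i) s"
    by (simp add: add_left_mono)
  also have "\<dots> \<le> epowr (f a + (\<Sum>i\<in>A. f i)) s" by (rule epowr_superadditive[OF assms(1)])
  finally show ?case using insert by simp
qed simp

text \<open>Young's inequality is integrated after dividing \<open>u\<close> and \<open>v\<close> by
  their norms, which must be positive and finite for this. Nothing is assumed integrable, so the
  degenerate cases are settled first.\<close>

lemma nn_integral_Holder:
  fixes u v :: "'a \<Rightarrow> real"
  assumes [measurable]: "u \<in> borel_measurable M" "v \<in> borel_measurable M"
    and nonneg: "\<And>x. 0 \<le> u x" "\<And>x. 0 \<le> v x"
    and pq: "1 < p" "1 < r" "1 / p + 1 / r = 1"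
  shows "(\<integral>\<^sup>+x. ennreal (u x * v x) \<partial>M) \<le>
    epowr (\<integral>\<^sup>+x. ennreal (u x powr p) \<partial>M) (1 / p) * epowr (\<integral>\<^sup>+x. ennreal (v x powr r) \<partial>M) (1 / r)"
    (is "?I \<le> epowr ?U _ * epowr ?V _")
proof -
  have zero: "(\<integral>\<^sup>+x. ennreal (g x * h x) \<partial>M) = 0"
    if "(\<integral>\<^sup>+x. ennreal (g x powr e) \<partial>M) = 0" and [measurable]: "g \<in> borel_measurable M"
      "h \<in> borel_measurable M" and "\<And>x. 0 \<le> g x" for g h :: "'a \<Rightarrow> real" and e
  proof -
    have "AE x in M. ennreal (g x powr e) = 0"
      using that(1) by (subst (asm) nn_integral_0_iff_AE) auto
    then have "AE x in M. ennreal (g x * h x) = 0"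
      by eventually_elim (auto simp: ennreal_eq_0_iff)
    then show ?thesis by (simp add: nn_integral_0_iff_AE)
  qed
  \<comment> \<open>A vanishing norm makes the integrand vanish almost everywhere, even if the other
    norm is infinite and the right side reads \<open>0 * top = 0\<close>. If neither vanishes and
    one is infinite, the right side is \<open>top\<close>.\<close>
  consider "?U = 0" | "?V = 0" | "?U \<noteq> 0" "?V \<noteq> 0" "?U = top \<or> ?V = top"
    | "?U \<noteq> 0" "?V \<noteq> 0" "?U \<noteq> top" "?V \<noteq> top" by blast
  then show ?thesis
  proof cases
    case 1
    then show ?thesis using zero[of u p v] nonneg by simp
  next
    case 2
    then show ?thesis using zero[of v r u] nonneg by (simp add: mult.commute)
  next
    case 3
    then have "epowr ?U (1 / p) * epowr ?V (1 / r) = top"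
      using pq by (auto simp: ennreal_mult_eq_top_iff epowr_eq_0_iff epowr_eq_top_iff)
    then show ?thesis by simp
  next
    case 4
    define a where "a = enn2real ?U"
    define b where "b = enn2real ?V"
    have U: "?U = ennreal a" and V: "?V = ennreal b"
      using 4 by (auto simp: a_def b_def less_top)
    have ab: "0 < a" "0 < b" using 4 U V by (auto simp: ennreal_eq_0_iff not_le)
    \<comment> \<open>\<open>s\<close> and \<open>t\<close> are the two norms; integrating the
      rescaled Young bound gives \<open>s * t * (1 / p + 1 / r)\<close>.\<close>
    define s where "s = a powr (1 / p)"
    define t where "t = b powr (1 / r)"
    have st: "0 < s" "0 < t" "s powr p = a" "t powr r = b"
      using ab pq by (auto simp: s_def t_def powr_powr)
    have young: "u x * v x \<le> s * t * (u x powr p / (p * a) + v x powr r / (r * b))" for x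
    proof -
      have "(u x / s) * (v x / t) \<le> (u x / s) powr p / p + (v x / t) powr r / r"
        using pq nonneg st by (intro Youngs_inequality) auto
      also have "\<dots> = u x powr p / (p * a) + v x powr r / (r * b)"
        using nonneg st by (simp add: powr_divide mult.commute)
      finally show ?thesis using st by (simp add: field_simps)
    qed
    have "?I \<le> (\<integral>\<^sup>+x. ennreal (s * t / (p * a)) * ennreal (u x powr p)
                 + ennreal (s * t / (r * b)) * ennreal (v x powr r) \<partial>M)"
    proof (rule nn_integral_mono)
      fix x
      have "u x * v x \<le> s * t / (p * a) * (u x powr p) + s * t / (r * b) * (v x powr r)"
        using young[of x] by (simp add: algebra_simps)
      then show "ennreal (u x * v x) \<le> ennreal (s * t / (p * a)) * ennreal (u x powr p)
                 + ennreal (s * t / (r * b)) * ennreal (v x powr r)"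
        using st ab pq by (simp add: ennreal_mult[symmetric] ennreal_plus[symmetric] ennreal_leI
            del: ennreal_plus)
    qed
    also have "\<dots> = ennreal (s * t / (p * a)) * ?U + ennreal (s * t / (r * b)) * ?V"
      by (simp add: nn_integral_add nn_integral_cmult)
    also have "\<dots> = ennreal (s * t / (p * a) * a + s * t / (r * b) * b)"
      using st ab pq by (simp add: U V ennreal_mult[symmetric] ennreal_plus[symmetric] del: ennreal_plus)
    also have "s * t / (p * a) * a + s * t / (r * b) * b = s * t * (1 / p + 1 / r)"
      using ab pq by (simp add: field_simps)
    also have "ennreal (s * t * (1 / p + 1 / r)) = epowr ?U (1 / p) * epowr ?V (1 / r)"
      using ab st by (simp add: pq U V epowr_ennreal ennreal_mult s_def t_def)
    finally show ?thesis .
  qed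
qed

section \<open>Intervals, boxes and the measure \<open>dV\<close>\<close>

lemma intervalsE:
  assumes "I \<in> intervals"
  obtains a b where "a < b" "{a<..<b} \<subseteq> I" "I \<subseteq> {a..b}" "ilen I = b - a" "I \<in> sets borel"
proof -
  obtain a b where ab: "a < b" "{a<..<b} \<subseteq> I" "I \<subseteq> {a..b}"
    using assms by (auto simp: intervals_def)
  have ne: "{a<..<b} \<noteq> {}" using ab(1) by simp
  have bdd: "bdd_above I" "bdd_below I"
    using ab(3) by (auto intro: bdd_above_mono bdd_below_mono)
  have "I \<noteq> {}" using ab(2) ne by blast
  then have "Sup {a<..<b} \<le> Sup I" "Sup I \<le> Sup {a..b}" "Inf I \<le> Inf {a<..<b}" "Inf {a..b} \<le> Inf I"
    using cSup_subset_mono[OF ne bdd(1) ab(2)] cSup_subset_mono[OF _ _ ab(3)]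
      cInf_superset_mono[OF ne bdd(2) ab(2)] cInf_superset_mono[OF _ _ ab(3)] by auto
  then have "ilen I = b - a" using ab(1) by (simp add: ilen_def)
  moreover have "I = {a<..<b} \<union> (I \<inter> {a, b})" using ab by force
  then have "I \<in> sets borel" 
    by (metis borel_open finite.emptyI finite_Int finite_insert finite_imp_closed borel_closed
        open_greaterThanLessThan sets.Un)
  ultimately show thesis using ab that by blast
qed

lemma ilen_pos: "I \<in> intervals \<Longrightarrow> 0 < ilen I"
  by (erule intervalsE) simp

lemma greaterThanLessThan_intervals: "a < b \<Longrightarrow> {a<..<b} \<in> intervals"
  unfolding intervals_def using greaterThanLessThan_subseteq_atLeastAtMost_iff by blast

lemma ilen_greaterThanLessThan [simp]: "a < b \<Longrightarrow> ilen {a<..<b} = b - a"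
  by (simp add: ilen_def)

lemma Qbox_borel [measurable]: "I \<in> intervals \<Longrightarrow> Qbox I \<in> sets borel"
proof (erule intervalsE)
  assume [measurable]: "I \<in> sets borel"
  have "{z \<in> space borel. Re z \<in> I \<and> 0 < Im z \<and> Im z < ilen I} \<in> sets borel" by measurable
  then show ?thesis by (simp add: Qbox_def)
qed

lemma Qbox_subset_UHP: "Qbox I \<subseteq> UHP"
  by (auto simp: Qbox_def UHP_def)

lemma UHP_borel [measurable]: "UHP \<in> sets borel"
  unfolding UHP_def by measurable

lemma sets_dV [measurable_cong, simp]: "sets (dV \<alpha>) = sets borel"
  by (simp add: dV_def)

lemma space_dV [simp]: "space (dV \<alpha>) = UNIV"
  by (simp add: dV_def)

lemma nn_integral_dV:
  "f \<in> borel_measurable borel \<Longrightarrow>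
    (\<integral>\<^sup>+z. f z \<partial>dV \<alpha>) = (\<integral>\<^sup>+z. indicator UHP z * ennreal (Im z powr \<alpha>) * f z \<partial>lborel)"
  unfolding dV_def by (subst nn_integral_density) auto

lemma AE_dV_UHP: "AE z in dV \<alpha>. z \<in> UHP"
  unfolding dV_def by (subst AE_density) (auto intro!: AE_I2 simp: indicator_def)

lemma measurable_Complex [measurable]:
  "(\<lambda>(x, y). Complex x y) \<in> borel_measurable (borel \<Otimes>\<^sub>M borel)"
proof -
  have "(\<lambda>z :: real \<times> real. Complex (fst z) (snd z)) \<in> borel_measurable borel"
    unfolding complex_eq
    by (intro borel_measurable_continuous_onI continuous_intros)
  then show ?thesis by (simp add: borel_prod case_prod_beta')
qed

text \<open>Both measures agree on boxes, which determines Lebesgue measure. Tonelli's theorem in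
  the coordinates \<open>Re z\<close> and \<open>Im z\<close> becomes available.\<close>

lemma lborel_complex_eq_distr:
  "(lborel :: complex measure) = distr (lborel \<Otimes>\<^sub>M lborel) borel (\<lambda>(x, y). Complex x y)"
proof (rule lborel_eqI)
  fix l u :: complex
  assume le: "\<And>b. b \<in> Basis \<Longrightarrow> l \<bullet> b \<le> u \<bullet> b"
  have le': "Re l \<le> Re u" "Im l \<le> Im u"
    using le[of 1] le[of \<i>] by (auto simp: Basis_complex_def inner_complex_def)
  have "(\<lambda>(x, y). Complex x y) -` box l u \<inter> space (lborel \<Otimes>\<^sub>M lborel)
      = box (Re l) (Re u) \<times> box (Im l) (Im u)"
    by (auto simp: box_def Basis_complex_def inner_complex_def space_pair_measure)
  then have "emeasure (distr (lborel \<Otimes>\<^sub>M lborel) borel (\<lambda>(x, y). Complex x y)) (box l u)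
    = ennreal (Re u - Re l) * ennreal (Im u - Im l)"
    using le' by (subst emeasure_distr) (simp_all add: lborel.emeasure_pair_measure_Times)
  also have "\<dots> = ennreal (\<Prod>b\<in>Basis. (u - l) \<bullet> b)"
    using le' by (simp add: Basis_complex_def inner_complex_def ennreal_mult)
  finally show "emeasure (distr (lborel \<Otimes>\<^sub>M lborel) borel (\<lambda>(x, y). Complex x y)) (box l u)
      = ennreal (\<Prod>b\<in>Basis. (u - l) \<bullet> b)" .
qed simp

text \<open>The integral factors into the length of \<open>I\<close> and the integral of
  \<open>y powr \<alpha>\<close> over the height, which converges at 0 because
  \<open>\<alpha> > -1\<close>.\<close>

lemma emeasure_Qbox:
  assumes "\<alpha> > -1" "I \<in> intervals"
  shows "emeasure (dV \<alpha>) (Qbox I) = ennreal (ilen I powr (2 + \<alpha>) / (1 + \<alpha>))"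
proof -
  obtain a b where ab: "a < b" "{a<..<b} \<subseteq> I" "I \<subseteq> {a..b}" "ilen I = b - a"
    and [measurable]: "I \<in> sets borel" using assms(2) by (rule intervalsE)
  let ?L = "ilen I"
  note [measurable] = Qbox_borel[OF assms(2)]
  have L: "0 < ?L" using ab by simp
  have "emeasure (dV \<alpha>) (Qbox I) = (\<integral>\<^sup>+z. indicator UHP z * ennreal (Im z powr \<alpha>) * indicator (Qbox I) z \<partial>lborel)"
    using nn_integral_dV[of "indicator (Qbox I)" \<alpha>] by simp
  also have "\<dots> = (\<integral>\<^sup>+w. indicator I (fst w) * (ennreal (snd w powr \<alpha>) * indicator {0<..<?L} (snd w))
      \<partial>(lborel \<Otimes>\<^sub>M lborel))"
    unfolding lborel_complex_eq_distr
    by (subst nn_integral_distr)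
       (auto intro!: nn_integral_cong simp: indicator_def Qbox_def UHP_def)
  also have "\<dots> = (\<integral>\<^sup>+x. \<integral>\<^sup>+y. indicator I x * (ennreal (y powr \<alpha>) * indicator {0<..<?L} y) \<partial>lborel \<partial>lborel)"
    by (subst lborel.nn_integral_fst[symmetric]) auto
  also have "\<dots> = emeasure lborel I * (\<integral>\<^sup>+y. ennreal (y powr \<alpha>) * indicator {0<..<?L} y \<partial>lborel)"
    by (simp add: nn_integral_cmult nn_integral_multc)
  \<comment> \<open>The endpoints are null; including them matches the closed-interval form of the
    power integral.\<close>
  also have "(\<integral>\<^sup>+y. ennreal (y powr \<alpha>) * indicator {0<..<?L} y \<partial>lborel)
      = (\<integral>\<^sup>+y. ennreal (y powr \<alpha>) * indicator {0..?L} y \<partial>lborel)"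
  proof (rule nn_integral_cong_AE)
    have "AE y in lborel. y \<noteq> 0 \<and> y \<noteq> ?L" using AE_lborel_singleton by (auto intro: AE_conjI)
    then show "AE y in lborel. ennreal (y powr \<alpha>) * indicator {0<..<?L} y
        = ennreal (y powr \<alpha>) * indicator {0..?L} y"
      by eventually_elim (auto simp: indicator_def)
  qed
  also have "\<dots> = ennreal (?L powr (\<alpha> + 1) / (\<alpha> + 1))"
    using has_integral_powr_from_0[OF assms(1)] L by (intro nn_integral_has_integral_lebesgue') auto
  also have "emeasure lborel I = ennreal ?L"
  proof (rule antisym)
    show "emeasure lborel I \<le> ennreal ?L"
      using emeasure_mono[OF ab(3), of lborel] ab by simp
    show "ennreal ?L \<le> emeasure lborel I"
      using emeasure_mono[OF ab(2), of lborel] ab by simp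
  qed
  also have "ennreal ?L * ennreal (?L powr (\<alpha> + 1) / (\<alpha> + 1)) = ennreal (?L powr (2 + \<alpha>) / (1 + \<alpha>))"
    using L assms(1) powr_mult_base[of ?L "\<alpha> + 1"]
    by (simp add: ennreal_mult[symmetric] add.commute add.left_commute)
  finally show ?thesis .
qed

lemma Qvol_eq: "\<alpha> > -1 \<Longrightarrow> I \<in> intervals \<Longrightarrow> Qvol \<alpha> I = ilen I powr (2 + \<alpha>) / (1 + \<alpha>)"
  by (simp add: Qvol_def measure_def emeasure_Qbox)

lemma Qvol_pos: "\<alpha> > -1 \<Longrightarrow> I \<in> intervals \<Longrightarrow> 0 < Qvol \<alpha> I"
  using ilen_pos[of I] by (simp add: Qvol_eq)

section \<open>Duality between weighted L^p and integration over a box\<close>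

text \<open>For a nonnegative weight this is the L^p' norm of \<open>1 / \<omega>\<close> over
  \<open>Q\<close> with respect to \<open>\<omega>\<close> times \<open>dV \<alpha>\<close>, with
  zeros of the weight counted as infinite: the norm of integration over \<open>Q\<close> as a
  functional on weighted L^p.\<close>

definition dual_norm :: "real \<Rightarrow> real \<Rightarrow> (complex \<Rightarrow> real) \<Rightarrow> complex set \<Rightarrow> ennreal" where
  "dual_norm p \<alpha> \<omega> Q =
    (if p = 1 then inverse (essinf_on \<alpha> \<omega> Q)
     else epowr (\<integral>\<^sup>+z\<in>Q. wpow \<omega> (1 - conj_exp p) z \<partial>dV \<alpha>) (1 / conj_exp p))"

lemma conj_exp_facts:
  assumes "1 < p"
  shows "1 < conj_exp p" "1 / p + 1 / conj_exp p = 1" "1 - conj_exp p = - conj_exp p / p"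
    "1 - conj_exp p < 0" "(1 - conj_exp p) * (p - 1) = - 1"
  using assms by (auto simp: conj_exp_def field_simps)

text \<open>Since 1/p + 1/p' = 1, the powers of the volume combine to the exponent
  \<open>-(1 - \<gamma> / (2 + \<alpha>))\<close>, which is the normalisation in (c).\<close>

lemma bfactor_eq:
  assumes "1 \<le> p" "0 < q" "\<alpha> > -1" "I \<in> intervals"
  shows "bfactor p q \<alpha> \<gamma> \<omega> I =
    epowr (ennreal (Qvol \<alpha> I powr (-(1 - \<gamma> / (2 + \<alpha>)))) * dual_norm p \<alpha> \<omega> (Qbox I)) q"
proof (cases "p = 1")
  case True
  then show ?thesis
    using assms(2)
    by (simp add: bfactor_def dual_norm_def epowr_mult epowr_ennreal powr_powr mult.commute[of q])
next
  case False
  then have p: "1 < p" using assms by simp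
  let ?K = "Qvol \<alpha> I" and ?r = "conj_exp p"
  have K: "0 < ?K" using Qvol_pos assms by simp
  have r: "1 < ?r" "1 / ?r = 1 - 1 / p" using conj_exp_facts[OF p] by auto
  define S where "S = (\<integral>\<^sup>+z\<in>Qbox I. wpow \<omega> (1 - ?r) z \<partial>dV \<alpha>)"
  have "S / ennreal ?K = ennreal (1 / ?K) * S"
    using K by (simp add: divide_ennreal_def inverse_ennreal inverse_eq_divide mult.commute)
  then have "epowr (S / ennreal ?K) (q / ?r) = ennreal (?K powr (- (q / ?r))) * epowr S (q / ?r)"
    using assms r K by (simp add: epowr_mult epowr_ennreal powr_minus powr_divide inverse_eq_divide)
  moreover have "?K powr (q * (\<gamma> / (2 + \<alpha>) - 1 / p)) * ?K powr (- (q / ?r)) =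
      ?K powr (-(1 - \<gamma> / (2 + \<alpha>)) * q)"
  proof -
    have "q * (\<gamma> / (2 + \<alpha>) - 1 / p) + - (q / ?r) = q * (\<gamma> / (2 + \<alpha>) - 1 / p - 1 / ?r)"
      by (simp add: algebra_simps)
    also have "\<dots> = -(1 - \<gamma> / (2 + \<alpha>)) * q" unfolding r(2) by (simp add: algebra_simps)
    finally show ?thesis by (metis powr_add)
  qed
  ultimately have "bfactor p q \<alpha> \<gamma> \<omega> I = ennreal (?K powr (-(1 - \<gamma> / (2 + \<alpha>)) * q)) * epowr S (q / ?r)"
    using False by (simp add: bfactor_def S_def mult.assoc[symmetric] ennreal_mult[symmetric])
  then show ?thesis
    using False assms(2) by (simp add: dual_norm_def epowr_mult epowr_ennreal powr_powr epowr_epowr S_def)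
qed

text \<open>The supremum defining the essential infimum is the supremum of a sequence, and countably
  many almost everywhere bounds hold simultaneously.\<close>

lemma AE_essinf_on:
  "AE z in dV \<alpha>. z \<in> Q \<longrightarrow> essinf_on \<alpha> \<omega> Q \<le> ennreal (\<omega> z)"
proof -
  let ?A = "{c. AE z in dV \<alpha>. z \<in> Q \<longrightarrow> c \<le> ennreal (\<omega> z)}"
  have "0 \<in> ?A" by simp
  then have "?A \<noteq> {}" by blast
  then obtain c :: "nat \<Rightarrow> ennreal" where c: "range c \<subseteq> ?A" "Sup ?A = (SUP i. c i)"
    using ennreal_Sup_countable_SUP[of ?A] by blast
  have "AE z in dV \<alpha>. \<forall>i. z \<in> Q \<longrightarrow> c i \<le> ennreal (\<omega> z)"
    using c(1) by (subst AE_all_countable) auto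
  moreover have "essinf_on \<alpha> \<omega> Q = (SUP i. c i)" using c(2) by (simp add: essinf_on_def)
  ultimately show ?thesis by (auto elim!: eventually_mono intro: SUP_least)
qed

lemma wpow_measurable [measurable]:
  assumes [measurable]: "\<omega> \<in> borel_measurable borel"
  shows "wpow \<omega> s \<in> borel_measurable borel"
  unfolding wpow_def[abs_def] by measurable

text \<open>For \<open>p > 1\<close> this is Hoelder's inequality with the weight split as
  \<omega>^(1/p) times \<omega>^(-1/p); for \<open>p = 1\<close> the weight is bounded below by its
  essential infimum. Finiteness of the dual norm rules out a right side \<open>0 * top = 0\<close>
  for \<open>f\<close> living on zeros of the weight.\<close>

lemma nn_integral_le_dual_norm:
  fixes f \<omega> :: "complex \<Rightarrow> real"
  assumes p: "1 \<le> p" and [measurable]: "f \<in> borel_measurable borel" "\<omega> \<in> borel_measurable borel" "Q \<in> sets borel"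
    and nonneg: "\<And>z. z \<in> Q \<Longrightarrow> 0 \<le> \<omega> z" and fin: "dual_norm p \<alpha> \<omega> Q \<noteq> top"
  shows "(\<integral>\<^sup>+z\<in>Q. ennreal \<bar>f z\<bar> \<partial>dV \<alpha>) \<le>
    epowr (\<integral>\<^sup>+z\<in>Q. ennreal (\<bar>f z\<bar> powr p * \<omega> z) \<partial>dV \<alpha>) (1 / p) * dual_norm p \<alpha> \<omega> Q"
proof (cases "p = 1")
  case True
  let ?m = "essinf_on \<alpha> \<omega> Q"
  have m: "?m \<noteq> 0" using fin True by (auto simp: dual_norm_def)
  have "(\<integral>\<^sup>+z\<in>Q. ennreal \<bar>f z\<bar> \<partial>dV \<alpha>) \<le>
      (\<integral>\<^sup>+z. ennreal (\<bar>f z\<bar> powr p * \<omega> z) * indicator Q z * inverse ?m \<partial>dV \<alpha>)"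
  proof (rule nn_integral_mono_AE)
    show "AE z in dV \<alpha>. ennreal \<bar>f z\<bar> * indicator Q z \<le>
        ennreal (\<bar>f z\<bar> powr p * \<omega> z) * indicator Q z * inverse ?m"
      using AE_essinf_on[where Q = Q and \<omega> = \<omega> and \<alpha> = \<alpha>]
    proof eventually_elim
      fix z assume z: "z \<in> Q \<longrightarrow> ?m \<le> ennreal (\<omega> z)"
      show "ennreal \<bar>f z\<bar> * indicator Q z \<le> ennreal (\<bar>f z\<bar> powr p * \<omega> z) * indicator Q z * inverse ?m"
      proof (cases "z \<in> Q")
        case True
        then have "?m < top" using z by (auto intro: le_less_trans)
        then have "1 = ?m * inverse ?m"
          using ennreal_divide_self[of ?m] m by (simp add: divide_ennreal_def)
        also have "\<dots> \<le> ennreal (\<omega> z) * inverse ?m" using z True by (auto intro: mult_right_mono)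
        finally have "ennreal \<bar>f z\<bar> * 1 \<le> ennreal \<bar>f z\<bar> * (ennreal (\<omega> z) * inverse ?m)"
          by (rule mult_left_mono) simp
        then show ?thesis
          using True \<open>p = 1\<close> nonneg by (simp add: ennreal_mult mult.assoc)
      qed simp
    qed
  qed
  also have "\<dots> = (\<integral>\<^sup>+z\<in>Q. ennreal (\<bar>f z\<bar> powr p * \<omega> z) \<partial>dV \<alpha>) * inverse ?m"
    by (rule nn_integral_multc) measurable
  finally show ?thesis using True by (simp add: dual_norm_def)
next
  case False
  then have p1: "1 < p" using p by simp
  let ?r = "conj_exp p"
  note r = conj_exp_facts[OF p1]
  define u where "u z = \<bar>f z\<bar> * \<omega> z powr (1 / p) * indicator Q z" for z
  define v where "v z = \<omega> z powr (- (1 / p)) * indicator Q z" for z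
  have [measurable]: "u \<in> borel_measurable borel" "v \<in> borel_measurable borel"
    unfolding u_def[abs_def] v_def[abs_def] by measurable
  have uv: "0 \<le> u z" "0 \<le> v z" for z by (simp_all add: u_def v_def)
  have "(\<integral>\<^sup>+z\<in>Q. wpow \<omega> (1 - ?r) z \<partial>dV \<alpha>) \<noteq> top"
    using fin False by (simp add: dual_norm_def epowr_eq_top_iff)
  then have "AE z in dV \<alpha>. wpow \<omega> (1 - ?r) z * indicator Q z \<noteq> \<infinity>"
    by (intro nn_integral_noteq_infinite) (auto simp: infinity_ennreal_def)
  \<comment> \<open>\<open>wpow\<close> is \<open>top\<close> at zeros of the weight, so finiteness
    of its integral makes the weight positive almost everywhere on \<open>Q\<close>.\<close>
  then have ne: "AE z in dV \<alpha>. z \<in> Q \<longrightarrow> 0 < \<omega> z"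
    by eventually_elim (use nonneg in \<open>force simp: wpow_def indicator_def less_le split: if_splits\<close>)
  have "(\<integral>\<^sup>+z\<in>Q. ennreal \<bar>f z\<bar> \<partial>dV \<alpha>) = (\<integral>\<^sup>+z. ennreal (u z * v z) \<partial>dV \<alpha>)"
  proof (rule nn_integral_cong_AE)
    show "AE z in dV \<alpha>. ennreal \<bar>f z\<bar> * indicator Q z = ennreal (u z * v z)"
      using ne by eventually_elim
        (auto simp: u_def v_def indicator_def mult.assoc powr_add[symmetric])
  qed
  also have "\<dots> \<le> epowr (\<integral>\<^sup>+z. ennreal (u z powr p) \<partial>dV \<alpha>) (1 / p)
      * epowr (\<integral>\<^sup>+z. ennreal (v z powr ?r) \<partial>dV \<alpha>) (1 / ?r)"
    using uv p1 r by (intro nn_integral_Holder) auto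
  also have "(\<integral>\<^sup>+z. ennreal (u z powr p) \<partial>dV \<alpha>) = (\<integral>\<^sup>+z\<in>Q. ennreal (\<bar>f z\<bar> powr p * \<omega> z) \<partial>dV \<alpha>)"
    using p1 nonneg
    by (intro nn_integral_cong) (auto simp: u_def indicator_def powr_mult powr_powr)
  \<comment> \<open>The exponent \<open>- (1 / p)\<close> times \<open>?r\<close> equals
    \<open>1 - ?r\<close>.\<close>
  also have "(\<integral>\<^sup>+z. ennreal (v z powr ?r) \<partial>dV \<alpha>) = (\<integral>\<^sup>+z\<in>Q. wpow \<omega> (1 - ?r) z \<partial>dV \<alpha>)"
  proof (rule nn_integral_cong_AE)
    show "AE z in dV \<alpha>. ennreal (v z powr ?r) = wpow \<omega> (1 - ?r) z * indicator Q z"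
      using ne by eventually_elim (auto simp: v_def indicator_def powr_powr wpow_def r(3))
  qed
  finally show ?thesis using False by (simp add: dual_norm_def)
qed

section \<open>Test functions bounding the dual norm\<close>

lemma loc_int_bounded:
  assumes [measurable]: "f \<in> borel_measurable borel" and le: "\<And>z. \<bar>f z\<bar> \<le> B"
  shows "loc_int f"
  unfolding loc_int_def
proof (intro conjI allI impI)
  fix K :: "complex set" assume K: "compact K \<and> K \<subseteq> UHP"
  then have [measurable]: "K \<in> sets borel" by (simp add: compact_imp_closed)
  have "(\<integral>\<^sup>+z. ennreal \<bar>f z\<bar> * indicator K z \<partial>lborel) \<le> (\<integral>\<^sup>+z. ennreal B * indicator K z \<partial>lborel)"
    by (intro nn_integral_mono mult_right_mono ennreal_leI le) auto
  also have "\<dots> = ennreal B * emeasure lborel K" by (simp add: nn_integral_cmult)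
  also have "\<dots> < \<infinity>"
    using K emeasure_bounded_finite[of K]
    by (simp add: ennreal_mult_less_top compact_imp_bounded)
  finally show "(\<integral>\<^sup>+z. ennreal \<bar>f z\<bar> * indicator K z \<partial>lborel) < \<infinity>" .
qed simp

lemma ennreal_inverse_inverse: "inverse (inverse (x::ennreal)) = x"
proof (cases x)
  case (real r)
  then show ?thesis by (cases "r = 0") (auto simp: inverse_ennreal)
qed simp

lemma ennreal_inverse_antimono:
  assumes "(x::ennreal) \<le> y" shows "inverse y \<le> inverse x"
proof (cases "x = 0 \<or> y = top")
  case False
  then obtain a b where "x = ennreal a" "y = ennreal b" "0 < a" "0 < b"
    using assms by (cases x; cases y) (auto simp: less_le top_unique)
  then show ?thesis using assms by (simp add: inverse_ennreal ennreal_leI)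
qed auto

text \<open>Inversion is an order-reversing involution, and the positive reals above
  \<open>m\<close> have infimum \<open>m\<close>. Levels strictly above an essential infimum can
  thus be tested one at a time; \<open>m = 0\<close> and \<open>m = top\<close> (empty index set)
  are covered.\<close>

lemma inverse_ennreal_eq_SUP:
  "inverse (m::ennreal) = (SUP c\<in>{c. 0 < c \<and> m < ennreal c}. inverse (ennreal c))"
proof (rule antisym)
  show "inverse m \<le> (SUP c\<in>{c. 0 < c \<and> m < ennreal c}. inverse (ennreal c))"
  proof (rule dense_le)
    fix y assume "y < inverse m"
    then have "m < inverse y"
      by (metis ennreal_inverse_antimono ennreal_inverse_inverse linorder_not_le)
    then obtain x where x: "m < x" "x < inverse y" using dense by blast
    then obtain c where c: "x = ennreal c" "0 \<le> c" by (cases x) auto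
    with x have "0 < c" by (cases "c = 0") auto
    moreover have "y \<le> inverse (ennreal c)"
      using x c by (metis ennreal_inverse_antimono ennreal_inverse_inverse less_imp_le)
    ultimately show "y \<le> (SUP c\<in>{c. 0 < c \<and> m < ennreal c}. inverse (ennreal c))"
      using x c by (intro SUP_upper2[of c]) auto
  qed
  show "(SUP c\<in>{c. 0 < c \<and> m < ennreal c}. inverse (ennreal c)) \<le> inverse m"
    by (intro SUP_least ennreal_inverse_antimono) auto
qed

lemma emeasure_Qbox_pos: "\<alpha> > -1 \<Longrightarrow> I \<in> intervals \<Longrightarrow> emeasure (dV \<alpha>) (Qbox I) \<noteq> 0"
  using ilen_pos[of I] by (simp add: emeasure_Qbox ennreal_eq_0_iff not_le)

lemma emeasure_Qbox_finite: "\<alpha> > -1 \<Longrightarrow> I \<in> intervals \<Longrightarrow> emeasure (dV \<alpha>) (Qbox I) \<noteq> top"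
  by (simp add: emeasure_Qbox)

text \<open>Converse of Hoelder's inequality: near-extremal functions are inserted into
  \<open>test\<close> and the common power of their integral is cancelled. \<open>B\<close> collects
  factors independent of \<open>f\<close>.\<close>

lemma dual_norm_le:
  assumes p: "1 \<le> p" "0 < q" and \<alpha>: "\<alpha> > -1" and I: "I \<in> intervals"
    and [measurable]: "\<omega> \<in> borel_measurable borel" and nonneg: "\<And>z. z \<in> Qbox I \<Longrightarrow> 0 \<le> \<omega> z"
    and test: "\<And>f. loc_int f \<Longrightarrow> epowr (\<integral>\<^sup>+z\<in>Qbox I. ennreal \<bar>f z\<bar> \<partial>dV \<alpha>) q * B
      \<le> C * epowr (\<integral>\<^sup>+z\<in>Qbox I. ennreal (\<bar>f z\<bar> powr p * \<omega> z) \<partial>dV \<alpha>) (q / p)"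
  shows "epowr (dual_norm p \<alpha> \<omega> (Qbox I)) q * B \<le> C"
proof (cases "p = 1")
  case True
  let ?Q = "Qbox I" and ?m = "essinf_on \<alpha> \<omega> (Qbox I)"
  note [measurable] = Qbox_borel[OF I]
  have "epowr (inverse (ennreal c)) q * B \<le> C" if c: "0 < c" "?m < ennreal c" for c
  proof -
    \<comment> \<open>Because \<open>c\<close> exceeds the essential infimum, \<open>E\<close> has
      positive measure, and also finite measure, so a power of it can be cancelled. As
      \<open>\<omega> < c\<close> on \<open>E\<close>, the right side is at most \<open>C\<close>
      times the power of \<open>c\<close> times the measure of \<open>E\<close>.\<close>
    define E where "E = {z \<in> ?Q. \<omega> z < c}"
    have "{z \<in> space borel. z \<in> ?Q \<and> \<omega> z < c} \<in> sets borel" by measurable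
    then have [measurable]: "E \<in> sets borel" by (simp add: E_def)
    have Epos: "emeasure (dV \<alpha>) E \<noteq> 0"
    proof
      assume "emeasure (dV \<alpha>) E = 0"
      then have "E \<in> null_sets (dV \<alpha>)" by (simp add: null_setsI)
      then have "AE z in dV \<alpha>. z \<in> ?Q \<longrightarrow> ennreal c \<le> ennreal (\<omega> z)"
        by (intro AE_I'[of E]) (auto simp: E_def not_le[symmetric] intro: ennreal_leI)
      then have "ennreal c \<le> ?m" unfolding essinf_on_def by (intro SUP_upper2[of "ennreal c"]) auto
      then show False using c by simp
    qed
    have "emeasure (dV \<alpha>) E \<le> emeasure (dV \<alpha>) ?Q" by (rule emeasure_mono) (auto simp: E_def)
    then have Efin: "emeasure (dV \<alpha>) E \<noteq> top"
      using emeasure_Qbox_finite[OF \<alpha> I] by (auto simp: top_unique)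
    have "epowr (\<integral>\<^sup>+z\<in>?Q. ennreal \<bar>indicator E z\<bar> \<partial>dV \<alpha>) q * B
        \<le> C * epowr (\<integral>\<^sup>+z\<in>?Q. ennreal (\<bar>indicator E z\<bar> powr p * \<omega> z) \<partial>dV \<alpha>) (q / p)"
      by (intro test loc_int_bounded[where B = 1]) (auto simp: indicator_def)
    also have "\<dots> \<le> C * epowr (ennreal c * emeasure (dV \<alpha>) E) q"
    proof -
      have "(\<integral>\<^sup>+z\<in>?Q. ennreal (\<bar>indicator E z\<bar> powr p * \<omega> z) \<partial>dV \<alpha>)
          \<le> (\<integral>\<^sup>+z. ennreal c * indicator E z \<partial>dV \<alpha>)"
        by (intro nn_integral_mono) (auto simp: indicator_def E_def True intro!: ennreal_leI)
      also have "\<dots> = ennreal c * emeasure (dV \<alpha>) E" by (simp add: nn_integral_cmult)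
      finally show ?thesis using True p by (auto intro!: mult_left_mono epowr_mono)
    qed
    also have "(\<integral>\<^sup>+z\<in>?Q. ennreal \<bar>indicator E z\<bar> \<partial>dV \<alpha>) = (\<integral>\<^sup>+z. indicator E z \<partial>dV \<alpha>)"
      by (intro nn_integral_cong) (auto simp: indicator_def E_def)
    also have "\<dots> = emeasure (dV \<alpha>) E" by simp
    finally have "epowr (emeasure (dV \<alpha>) E) q * B
        \<le> epowr (emeasure (dV \<alpha>) E) q * (C * epowr (ennreal c) q)"
      using p by (simp add: epowr_mult mult_ac)
    then have "B \<le> C * epowr (ennreal c) q"
      using Epos Efin p by (subst (asm) ennreal_mult_le_mult_iff) (auto simp: epowr_eq_0_iff epowr_eq_top_iff)
    then have "epowr (inverse (ennreal c)) q * B \<le> epowr (inverse (ennreal c)) q * (C * epowr (ennreal c) q)"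
      by (rule mult_left_mono) simp
    also have "\<dots> = C * epowr (inverse (ennreal c) * ennreal c) q"
      using p by (simp add: epowr_mult mult_ac)
    also have "inverse (ennreal c) * ennreal c = ennreal 1"
      using c by (simp add: inverse_ennreal ennreal_mult[symmetric] del: ennreal_1)
    finally show ?thesis by (simp add: epowr_ennreal del: ennreal_1) simp
  qed
  then have "(SUP c\<in>{c. 0 < c \<and> ?m < ennreal c}. epowr (inverse (ennreal c)) q * B) \<le> C"
    by (intro SUP_least) auto
  then show ?thesis
    using True p
    by (simp add: dual_norm_def inverse_ennreal_eq_SUP[of ?m] epowr_SUP SUP_mult_right_ennreal)
next
  case False
  then have p1: "1 < p" using p by simp
  let ?r = "conj_exp p" and ?Q = "Qbox I"
  note r = conj_exp_facts[OF p1] and [measurable] = Qbox_borel[OF I]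
  define s where "s = 1 - ?r"
  \<comment> \<open>The extremal function in Hoelder's inequality is \<open>wpow \<omega> s\<close>,
    whose integral may be infinite. Truncation makes the integral finite, and starting at height 1
    instead of 0 keeps it nonzero for every \<open>n\<close>; cancellation needs both.\<close>
  define f where "f n z = enn2real (min (of_nat (Suc n)) (wpow \<omega> s z)) * indicator ?Q z" for n z
  define S where "S n = (\<integral>\<^sup>+z\<in>?Q. min (of_nat (Suc n)) (wpow \<omega> s z) \<partial>dV \<alpha>)" for n
  have [measurable]: "f n \<in> borel_measurable borel" for n
    unfolding f_def[abs_def] by measurable
  have f_eq: "ennreal (f n z) = min (of_nat (Suc n)) (wpow \<omega> s z) * indicator ?Q z" for n z
    by (auto simp: f_def indicator_def ennreal_enn2real_if min_def top_unique)
  have f_nonneg: "0 \<le> f n z" for n z by (simp add: f_def)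
  have f_le: "f n z \<le> real (Suc n)" for n z
  proof -
    have "ennreal (f n z) \<le> ennreal (real (Suc n))"
      unfolding f_eq ennreal_of_nat_eq_real_of_nat by (auto simp: indicator_def)
    then show ?thesis by (subst (asm) ennreal_le_iff) auto
  qed
  \<comment> \<open>Since \<open>f n\<close> stays below the power \<open>s\<close> of the weight
    and \<open>s * (p - 1) = - 1\<close>, the factor \<open>f n z powr (p - 1)\<close> is at most
    the inverse of the weight. Hence the weighted integral of \<open>f n z powr p\<close> is at most
    \<open>S n\<close>.\<close>
  have f_powr: "f n z powr p * \<omega> z \<le> f n z" if "z \<in> ?Q" for n z
  proof (cases "\<omega> z = 0")
    case True
    then show ?thesis using f_nonneg by simp
  next
    case False
    then have w: "0 < \<omega> z" using nonneg[OF that] by simp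
    have "ennreal (f n z) \<le> ennreal (\<omega> z powr s)"
      unfolding f_eq using that w by (simp add: wpow_def)
    then have "f n z \<le> \<omega> z powr s" by (subst (asm) ennreal_le_iff) auto
    then have "f n z powr (p - 1) \<le> (\<omega> z powr s) powr (p - 1)"
      using p1 f_nonneg by (intro powr_mono2) auto
    also have "\<dots> = inverse (\<omega> z)"
      using w r(5) by (simp add: powr_powr s_def powr_minus)
    finally have "f n z * (f n z powr (p - 1) * \<omega> z) \<le> f n z * (inverse (\<omega> z) * \<omega> z)"
      using w f_nonneg by (intro mult_left_mono mult_right_mono) auto
    then show ?thesis
      using w powr_mult_base[OF f_nonneg, of n z "p - 1"] by (simp add: mult.assoc[symmetric])
  qed
  have S_eq: "(\<integral>\<^sup>+z\<in>?Q. ennreal \<bar>f n z\<bar> \<partial>dV \<alpha>) = S n" for n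
    unfolding S_def using f_nonneg by (intro nn_integral_cong) (auto simp: f_eq indicator_def)
  have S_pos: "S n \<noteq> 0" for n
  proof
    assume "S n = 0"
    then have "AE z in dV \<alpha>. min (of_nat (Suc n)) (wpow \<omega> s z) * indicator ?Q z = 0"
      unfolding S_def by (subst (asm) nn_integral_0_iff_AE) auto
    then have "AE z in dV \<alpha>. z \<notin> ?Q"
      by eventually_elim (auto simp: indicator_def wpow_def min_def ennreal_eq_0_iff split: if_splits)
    then have "emeasure (dV \<alpha>) ?Q = 0" by (subst (asm) AE_iff_null) (auto intro: null_setsD1)
    then show False using emeasure_Qbox_pos[OF \<alpha> I] by simp
  qed
  have S_fin: "S n \<noteq> top" for n
  proof -
    have "S n \<le> (\<integral>\<^sup>+z. of_nat (Suc n) * indicator ?Q z \<partial>dV \<alpha>)"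
      unfolding S_def by (intro nn_integral_mono mult_right_mono) auto
    also have "\<dots> = of_nat (Suc n) * emeasure (dV \<alpha>) ?Q" by (subst nn_integral_cmult) auto
    also have "\<dots> < top"
      using emeasure_Qbox_finite[OF \<alpha> I] by (simp add: ennreal_mult_less_top less_top of_nat_less_top)
    finally show ?thesis by simp
  qed
  have bound: "epowr (S n) (q / ?r) * B \<le> C" for n
  proof -
    have "epowr (S n) q * B \<le> C * epowr (\<integral>\<^sup>+z\<in>?Q. ennreal (\<bar>f n z\<bar> powr p * \<omega> z) \<partial>dV \<alpha>) (q / p)"
      unfolding S_eq[symmetric]
      using f_nonneg f_le by (intro test loc_int_bounded[where B = "real (Suc n)"]) auto
    also have "\<dots> \<le> C * epowr (S n) (q / p)"
      unfolding S_eq[symmetric] using p f_nonneg f_powr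
      by (intro mult_left_mono epowr_mono nn_integral_mono) (auto simp: indicator_def intro!: ennreal_leI)
    \<comment> \<open>Cancelling the power \<open>q / p\<close> of \<open>S n\<close> leaves
      \<open>q / ?r\<close>, the exponent with which the integral enters the \<open>q\<close>-th
      power of the dual norm.\<close>
    also have "q = q / p + q / ?r"
    proof -
      have "q / p + q / ?r = q * (1 / p + 1 / ?r)" by (simp add: distrib_left)
      then show ?thesis by (simp add: r(2))
    qed
    then have "epowr (S n) q = epowr (S n) (q / p) * epowr (S n) (q / ?r)"
      using p r by (metis epowr_add divide_pos_pos less_le_trans zero_less_one less_trans)
    finally have "epowr (S n) (q / p) * (epowr (S n) (q / ?r) * B) \<le> epowr (S n) (q / p) * C"
      by (simp add: mult_ac)
    then show ?thesis
      using S_pos S_fin p by (subst (asm) ennreal_mult_le_mult_iff) (auto simp: epowr_eq_0_iff epowr_eq_top_iff)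
  qed
  \<comment> \<open>Monotone convergence removes the truncation.\<close>
  have "(\<integral>\<^sup>+z\<in>?Q. wpow \<omega> s z \<partial>dV \<alpha>) = (\<integral>\<^sup>+z. (SUP n. min (of_nat (Suc n)) (wpow \<omega> s z) * indicator ?Q z) \<partial>dV \<alpha>)"
  proof (rule nn_integral_cong)
    fix z
    have "(SUP n. of_nat n :: ennreal) \<le> (SUP n. of_nat (Suc n))"
      by (intro SUP_mono) (metis UNIV_I le_SucI of_nat_mono order_refl)
    then have SUP_Suc: "(SUP n. of_nat (Suc n) :: ennreal) = top"
      by (simp only: ennreal_SUP_of_nat_eq_top top_unique)
    then have "(SUP n. min (of_nat (Suc n)) (wpow \<omega> s z)) = wpow \<omega> s z"
      by (simp only: inf_min[symmetric] SUP_inf[symmetric] SUP_Suc inf_top_left)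
    then show "wpow \<omega> s z * indicator ?Q z = (SUP n. min (of_nat (Suc n)) (wpow \<omega> s z) * indicator ?Q z)"
      by (simp add: SUP_mult_right_ennreal[symmetric])
  qed
  also have "\<dots> = (SUP n. S n)"
    unfolding S_def
    by (intro nn_integral_monotone_convergence_SUP)
       (auto simp: incseq_def le_fun_def intro!: mult_right_mono min.mono)
  finally have "epowr (dual_norm p \<alpha> \<omega> ?Q) q = (SUP n. epowr (S n) (q / ?r))"
    using False p r by (simp add: dual_norm_def epowr_epowr epowr_SUP s_def)
  then show ?thesis using bound by (simp add: SUP_mult_right_ennreal SUP_le_iff)
qed

section \<open>Superlevel sets of the maximal function\<close>

definition box_avg :: "real \<Rightarrow> real \<Rightarrow> (complex \<Rightarrow> real) \<Rightarrow> real set \<Rightarrow> ennreal" where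
  "box_avg \<alpha> \<gamma> f I = ennreal (ilen I powr (-(2 + \<alpha> - \<gamma>))) * (\<integral>\<^sup>+w\<in>Qbox I. ennreal \<bar>f w\<bar> \<partial>dV \<alpha>)"

lemma open_Qbox: "open (Qbox {a<..<b})"
  unfolding Qbox_def greaterThanLessThan_iff
  by (intro open_Collect_conj open_Collect_less continuous_intros)

lemma less_Mfrac_iff:
  "t < Mfrac \<alpha> \<gamma> f z \<longleftrightarrow> (\<exists>I\<in>intervals. z \<in> Qbox I \<and> t < box_avg \<alpha> \<gamma> f I)"
  by (auto simp: Mfrac_def box_avg_def less_SUP_iff)

text \<open>The prefactor is continuous in the length and the integral can only grow, so a strict
  bound survives a small enlargement. Arbitrary intervals can thus be replaced by open ones, which
  makes superlevel sets open.\<close>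

lemma box_avg_enlarge:
  assumes "I \<in> intervals" "t < box_avg \<alpha> \<gamma> f I"
  obtains a b where "a < b" "Qbox I \<subseteq> Qbox {a<..<b}" "t < box_avg \<alpha> \<gamma> f {a<..<b}"
proof -
  obtain a b where ab: "a < b" "I \<subseteq> {a..b}" "ilen I = b - a"
    using assms(1) by (rule intervalsE)
  define J where "J = (\<integral>\<^sup>+w\<in>Qbox I. ennreal \<bar>f w\<bar> \<partial>dV \<alpha>)"
  \<comment> \<open>Only the length is changed here, not the domain of integration, so
    \<open>g e\<close> is explicit in \<open>e\<close> and bounds the average over the enlarged box
    from below.\<close>
  define g where "g e = ennreal ((b - a + 2 * e) powr (-(2 + \<alpha> - \<gamma>))) * J" for e
  have "eventually (\<lambda>e. t < g e) (at_right 0)"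
  \<comment> \<open>The limit argument uses continuity of multiplication by a finite
    \<open>J\<close>; for infinite \<open>J\<close> every \<open>g e\<close> with
    \<open>0 < e\<close> is \<open>top\<close>.\<close>
  proof (cases "J = top")
    case True
    have "eventually (\<lambda>e::real. 0 < e) (at_right 0)" by (rule eventually_at_right_less)
    then show ?thesis
    proof eventually_elim
      case (elim e)
      then have "g e = top" using ab(1) True by (simp add: g_def ennreal_mult_top ennreal_eq_0_iff)
      then show ?case using assms(2) by (metis less_top top.not_eq_extremum order_less_trans)
    qed
  next
    case False
    have "((\<lambda>e. J * ennreal ((b - a + 2 * e) powr (-(2 + \<alpha> - \<gamma>)))) \<longlongrightarrow>
        J * ennreal ((b - a + 2 * 0) powr (-(2 + \<alpha> - \<gamma>)))) (at_right 0)"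
      using ab(1) False by (intro ennreal_tendsto_cmult tendsto_intros) (auto simp: less_top)
    moreover have "t < J * ennreal ((b - a + 2 * 0) powr (-(2 + \<alpha> - \<gamma>)))"
      using assms(2) ab by (simp add: box_avg_def J_def mult.commute)
    ultimately show ?thesis
      unfolding g_def mult.commute[of _ J] by (rule order_tendstoD(1))
  qed
  moreover have "eventually (\<lambda>e::real. 0 < e) (at_right 0)" by (rule eventually_at_right_less)
  ultimately have "eventually (\<lambda>e. t < g e \<and> 0 < e) (at_right 0)" by (rule eventually_conj)
  then obtain e where e: "t < g e" "0 < e"
    using eventually_happens trivial_limit_at_right_real by blast
  have sub: "Qbox I \<subseteq> Qbox {a - e<..<b + e}"
    using ab e by (force simp: Qbox_def)
  have len: "ilen {a - e<..<b + e} = b - a + 2 * e"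
    using ab e by simp
  have "g e \<le> box_avg \<alpha> \<gamma> f {a - e<..<b + e}"
    unfolding g_def J_def box_avg_def len by (intro mult_left_mono nn_set_integral_set_mono sub) simp
  then show thesis using that[of "a - e" "b + e"] ab e sub by auto
qed

lemma superlevel_Mfrac:
  "{z \<in> UHP. t < Mfrac \<alpha> \<gamma> f z} =
    (\<Union>(a, b)\<in>{(a, b). a < b \<and> t < box_avg \<alpha> \<gamma> f {a<..<b}}. Qbox {a<..<b})"
  (is "_ = ?R")
proof (intro equalityI subsetI)
  fix z assume "z \<in> {z \<in> UHP. t < Mfrac \<alpha> \<gamma> f z}"
  then obtain I where I: "I \<in> intervals" "z \<in> Qbox I" "t < box_avg \<alpha> \<gamma> f I"
    by (auto simp: less_Mfrac_iff)
  from box_avg_enlarge[OF I(1,3)] obtain a b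
    where "a < b" "Qbox I \<subseteq> Qbox {a<..<b}" "t < box_avg \<alpha> \<gamma> f {a<..<b}" .
  then show "z \<in> ?R" using I by blast
next
  fix z assume "z \<in> ?R"
  then show "z \<in> {z \<in> UHP. t < Mfrac \<alpha> \<gamma> f z}"
    using Qbox_subset_UHP by (auto simp: less_Mfrac_iff intro!: bexI greaterThanLessThan_intervals)
qed

lemma open_superlevel_Mfrac: "open {z \<in> UHP. t < Mfrac \<alpha> \<gamma> f z}"
  unfolding superlevel_Mfrac by (auto intro!: open_Qbox)

section \<open>Covering by finitely many disjoint boxes\<close>

text \<open>Greedy selection: a longest interval is kept, those meeting it are no longer and hence
  lie in its triple, and the induction continues with the rest. The pair \<open>2 * a - b\<close>,
  \<open>2 * b - a\<close> gives the ends of the concentric triple, whose box is also tall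
  enough.\<close>

lemma Vitali_Qbox:
  assumes "finite F" "\<And>a b. (a, b) \<in> F \<Longrightarrow> a < b"
  obtains G where "G \<subseteq> F" "disjoint_family_on (\<lambda>(a, b). Qbox {a<..<b}) G"
    "(\<Union>(a, b)\<in>F. Qbox {a<..<b}) \<subseteq> (\<Union>(a, b)\<in>G. Qbox {2 * a - b<..<2 * b - a})"
  using assms
proof (induction F arbitrary: thesis rule: finite_psubset_induct)
  case (psubset F)
  show ?case
  proof (cases "F = {}")
    case True
    then show ?thesis using psubset.prems(1)[of "{}"] by (simp add: disjoint_family_on_def)
  next
    case False
    let ?len = "\<lambda>(a, b). b - a :: real"
    have "Max (?len ` F) \<in> ?len ` F" using False psubset.hyps by (intro Max_in) auto
    then obtain a b where ab: "(a, b) \<in> F" "b - a = Max (?len ` F)" by auto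
    have longest: "d - c \<le> b - a" if "(c, d) \<in> F" for c d
    proof -
      have "?len (c, d) \<in> ?len ` F" using that by (rule imageI)
      then show ?thesis unfolding ab(2) using psubset.hyps by (intro Max_ge) auto
    qed
    \<comment> \<open>For nonempty open intervals the condition is disjointness from
      \<open>(a, b)\<close>, which passes to the boxes. It fails for \<open>(a, b)\<close> itself,
      so the induction descends.\<close>
    define F' where "F' = {(c, d) \<in> F. d \<le> a \<or> b \<le> c}"
    have "a < b" using ab psubset.prems(2) by simp
    then have "(a, b) \<notin> F'" by (simp add: F'_def)
    then have F': "F' \<subset> F" using ab(1) by (auto simp: F'_def)
    have ord: "c < d" if "(c, d) \<in> F'" for c d using that psubset.prems(2) by (simp add: F'_def)
    obtain G where G: "G \<subseteq> F'" "disjoint_family_on (\<lambda>(a, b). Qbox {a<..<b}) G"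
      "(\<Union>(a, b)\<in>F'. Qbox {a<..<b}) \<subseteq> (\<Union>(a, b)\<in>G. Qbox {2 * a - b<..<2 * b - a})"
      by (rule psubset.IH[OF F' _ ord])
    have "disjoint_family_on (\<lambda>(a, b). Qbox {a<..<b}) (insert (a, b) G)"
      using G(1,2) \<open>(a, b) \<notin> F'\<close>
      by (subst disjoint_family_on_insert) (auto simp: F'_def Qbox_def)
    moreover have "Qbox {c<..<d} \<subseteq> Qbox {2 * a - b<..<2 * b - a}"
      if "(c, d) \<in> F" "\<not> (d \<le> a \<or> b \<le> c)" for c d
    proof -
      have "c < d" "d - c \<le> b - a" using that psubset.prems(2) longest by auto
      then show ?thesis using that \<open>a < b\<close> by (auto simp: Qbox_def)
    qed
    then have "(\<Union>(a, b)\<in>F. Qbox {a<..<b}) \<subseteq> (\<Union>(a, b)\<in>insert (a, b) G. Qbox {2 * a - b<..<2 * b - a})"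
      using G(3) by (fastforce simp: F'_def)
    ultimately show ?thesis using psubset.prems(1)[of "insert (a, b) G"] G(1) ab(1) F' by blast
  qed
qed

text \<open>Continuity from below along an enumeration. It carries bounds from finite families, in
  which a longest interval exists, to countable ones.\<close>

lemma emeasure_Union_le_finite:
  assumes "countable \<A>" "\<A> \<subseteq> sets M"
    and le: "\<And>\<F>. finite \<F> \<Longrightarrow> \<F> \<subseteq> \<A> \<Longrightarrow> emeasure M (\<Union>\<F>) \<le> c"
  shows "emeasure M (\<Union>\<A>) \<le> c"
proof (cases "\<A> = {}")
  case False
  define U where "U n = (\<Union>i<n. from_nat_into \<A> i)" for n :: nat
  have mem: "from_nat_into \<A> i \<in> \<A>" for i using False by (rule from_nat_into)
  have "\<Union>\<A> = (\<Union>i. from_nat_into \<A> i)"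
    using range_from_nat_into[OF False assms(1)] by simp
  also have "\<dots> = (\<Union>n. U n)" by (auto simp: U_def)
  finally have Un: "\<Union>\<A> = (\<Union>n. U n)" .
  have "incseq U" unfolding U_def incseq_def by (intro allI impI UN_mono) auto
  moreover have "range U \<subseteq> sets M"
    using assms(2) mem by (auto simp: U_def intro!: sets.finite_UN)
  ultimately have "emeasure M (\<Union>\<A>) = (SUP n. emeasure M (U n))"
    unfolding Un by (rule SUP_emeasure_incseq[symmetric, rotated])
  also have "\<dots> \<le> c"
  proof (rule SUP_least)
    fix n show "emeasure M (U n) \<le> c"
      unfolding U_def using le[of "from_nat_into \<A> ` {..<n}"] mem by auto
  qed
  finally show ?thesis .
qed simp

section \<open>Passing between the three conditions\<close>

text \<open>Isolated from (c) so that it can be asserted for a single interval and for Borel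
  functions that are not locally integrable.\<close>

definition box_ineq ::
  "real \<Rightarrow> real \<Rightarrow> real \<Rightarrow> real \<Rightarrow> (complex \<Rightarrow> real) \<Rightarrow> complex measure \<Rightarrow> real \<Rightarrow> (complex \<Rightarrow> real) \<Rightarrow> real set \<Rightarrow> bool" where
  "box_ineq p q \<alpha> \<gamma> \<omega> \<mu> C f I \<longleftrightarrow>
    epowr (ennreal (Qvol \<alpha> I powr (-(1 - \<gamma> / (2 + \<alpha>)))) * (\<integral>\<^sup>+z\<in>Qbox I. ennreal \<bar>f z\<bar> \<partial>dV \<alpha>)) q
      * emeasure \<mu> (Qbox I)
    \<le> ennreal C * epowr (\<integral>\<^sup>+z\<in>Qbox I. ennreal (\<bar>f z\<bar> powr p * \<omega> z) \<partial>dV \<alpha>) (q / p)"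

text \<open>Conditions (b) and (c) normalise by volume, the maximal function by length. The
  conversion factor found here enters the constants in both directions between weak type and box
  inequalities.\<close>

lemma Qvol_powr:
  assumes "\<alpha> > -1" "I \<in> intervals"
  shows "Qvol \<alpha> I powr (-(1 - \<gamma> / (2 + \<alpha>))) =
    (1 + \<alpha>) powr (1 - \<gamma> / (2 + \<alpha>)) * ilen I powr (-(2 + \<alpha> - \<gamma>))"
proof -
  have "(2 + \<alpha>) * (-(1 - \<gamma> / (2 + \<alpha>))) = -(2 + \<alpha> - \<gamma>)"
    using assms(1) by (simp add: field_simps)
  then have "(ilen I powr (2 + \<alpha>)) powr (-(1 - \<gamma> / (2 + \<alpha>))) = ilen I powr (-(2 + \<alpha> - \<gamma>))"
    by (simp only: powr_powr)
  moreover have "(1 + \<alpha>) powr (-(1 - \<gamma> / (2 + \<alpha>))) = inverse ((1 + \<alpha>) powr (1 - \<gamma> / (2 + \<alpha>)))"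
    by (rule powr_minus)
  ultimately show ?thesis
    using assms ilen_pos[of I] by (simp only: Qvol_eq powr_divide[of "ilen I powr (2 + \<alpha>)"] )
       (simp add: divide_inverse)
qed

lemma box_ineq_iff_avg:
  assumes "\<alpha> > -1" "I \<in> intervals"
  shows "box_ineq p q \<alpha> \<gamma> \<omega> \<mu> C f I \<longleftrightarrow>
    epowr (ennreal ((1 + \<alpha>) powr (1 - \<gamma> / (2 + \<alpha>))) * box_avg \<alpha> \<gamma> f I) q * emeasure \<mu> (Qbox I)
    \<le> ennreal C * epowr (\<integral>\<^sup>+z\<in>Qbox I. ennreal (\<bar>f z\<bar> powr p * \<omega> z) \<partial>dV \<alpha>) (q / p)"
  unfolding box_ineq_def box_avg_def Qvol_powr[OF assms] by (simp add: ennreal_mult mult.assoc)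

lemma box_ineq_if_bfactor:
  assumes "1 \<le> p" "0 < q" "\<alpha> > -1" "weight \<omega>"
    and "I \<in> intervals" "f \<in> borel_measurable borel"
    and b: "bfactor p q \<alpha> \<gamma> \<omega> I * emeasure \<mu> (Qbox I) \<le> ennreal C"
  shows "box_ineq p q \<alpha> \<gamma> \<omega> \<mu> C f I"
proof -
  let ?K = "ennreal (Qvol \<alpha> I powr (-(1 - \<gamma> / (2 + \<alpha>))))" and ?N = "dual_norm p \<alpha> \<omega> (Qbox I)"
  let ?F = "\<integral>\<^sup>+z\<in>Qbox I. ennreal (\<bar>f z\<bar> powr p * \<omega> z) \<partial>dV \<alpha>"
  have \<omega>: "\<omega> \<in> borel_measurable borel" "\<And>z. z \<in> Qbox I \<Longrightarrow> 0 \<le> \<omega> z"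
    using assms(4) Qbox_subset_UHP by (auto simp: weight_def loc_int_def)
  have b': "epowr (?K * ?N) q * emeasure \<mu> (Qbox I) \<le> ennreal C"
    using b assms by (simp add: bfactor_eq)
  show ?thesis
  proof (cases "?N = top")
    \<comment> \<open>An infinite dual norm makes the factor of
      \<open>emeasure \<mu> (Qbox I)\<close> infinite, so the finite bound forces the box to be null
      for \<open>\<mu>\<close>.\<close>
    case True
    have "?K \<noteq> 0" using Qvol_pos[OF assms(3,5)] by simp
    then have "epowr (?K * ?N) q = top" unfolding True by (simp add: ennreal_mult_top)
    then have "emeasure \<mu> (Qbox I) = 0"
      using b' by (auto simp: ennreal_top_mult top_unique split: if_splits)
    then show ?thesis by (simp add: box_ineq_def)
  next
    case False
    have "epowr (?K * (\<integral>\<^sup>+z\<in>Qbox I. ennreal \<bar>f z\<bar> \<partial>dV \<alpha>)) q * emeasure \<mu> (Qbox I)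
        \<le> epowr (?K * (epowr ?F (1 / p) * ?N)) q * emeasure \<mu> (Qbox I)"
      using assms \<omega> False
      by (intro mult_right_mono epowr_mono mult_left_mono nn_integral_le_dual_norm Qbox_borel) auto
    also have "\<dots> = epowr ?F (q / p) * (epowr (?K * ?N) q * emeasure \<mu> (Qbox I))"
      using assms(2) by (simp add: epowr_mult epowr_epowr mult_ac)
    also have "\<dots> \<le> epowr ?F (q / p) * ennreal C" by (rule mult_left_mono[OF b']) simp
    finally show ?thesis by (simp add: box_ineq_def mult.commute)
  qed
qed

lemma bfactor_le_if_box_ineq:
  assumes "1 \<le> p" "0 < q" "\<alpha> > -1" "weight \<omega>" "I \<in> intervals"
    and c: "\<And>f. loc_int f \<Longrightarrow> box_ineq p q \<alpha> \<gamma> \<omega> \<mu> C f I"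
  shows "bfactor p q \<alpha> \<gamma> \<omega> I * emeasure \<mu> (Qbox I) \<le> ennreal C"
proof -
  have \<omega>: "\<omega> \<in> borel_measurable borel" "\<And>z. z \<in> Qbox I \<Longrightarrow> 0 \<le> \<omega> z"
    using assms(4) Qbox_subset_UHP by (auto simp: weight_def loc_int_def)
  let ?K = "epowr (ennreal (Qvol \<alpha> I powr (-(1 - \<gamma> / (2 + \<alpha>))))) q"
  \<comment> \<open>The role of \<open>B\<close> is played by the power of the volume times the
    measure of the box.\<close>
  have "epowr (dual_norm p \<alpha> \<omega> (Qbox I)) q * (?K * emeasure \<mu> (Qbox I)) \<le> ennreal C"
    using c assms(2) by (intro dual_norm_le assms \<omega>) (auto simp: box_ineq_def epowr_mult mult_ac)
  then show ?thesis using assms by (simp add: bfactor_eq epowr_mult mult_ac)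
qed

text \<open>Every \<open>x\<close> below the average is exceeded by the maximal function on the
  whole box, so the weak type bound applies at level \<open>x\<close>. Taking the supremum over
  \<open>x\<close> also covers infinite averages.\<close>

lemma box_ineq_if_weak_type:
  assumes "1 \<le> p" "0 < q" "\<alpha> > -1" "weight \<omega>" "sets \<mu> = sets borel" "0 < C"
    and I: "I \<in> intervals" and [measurable]: "f \<in> borel_measurable borel"
    and a: "\<And>g t. g \<in> borel_measurable borel \<Longrightarrow> integrable (dV \<alpha>) (\<lambda>z. \<bar>g z\<bar> powr p * \<omega> z) \<Longrightarrow>
      0 < t \<Longrightarrow> emeasure \<mu> {z \<in> UHP. ennreal t < Mfrac \<alpha> \<gamma> g z}
        \<le> ennreal (C / t powr q * (\<integral>z. \<bar>g z\<bar> powr p * \<omega> z \<partial>dV \<alpha>) powr (q / p))"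
  shows "box_ineq p q \<alpha> \<gamma> \<omega> \<mu> (((1 + \<alpha>) powr (1 - \<gamma> / (2 + \<alpha>))) powr q * C) f I"
proof -
  let ?F = "\<integral>\<^sup>+z\<in>Qbox I. ennreal (\<bar>f z\<bar> powr p * \<omega> z) \<partial>dV \<alpha>"
  let ?k = "(1 + \<alpha>) powr (1 - \<gamma> / (2 + \<alpha>))"
  have \<omega>: "\<omega> \<in> borel_measurable borel" "\<And>z. z \<in> Qbox I \<Longrightarrow> 0 \<le> \<omega> z"
    using assms(4) Qbox_subset_UHP by (auto simp: weight_def loc_int_def)
  note [measurable] = \<omega>(1) Qbox_borel[OF I]
  have k: "0 < ?k" using assms by simp
  show ?thesis
  proof (cases "?F = top")
    case True
    then show ?thesis using assms k by (simp add: box_ineq_def ennreal_mult_top)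
  next
    case False
    \<comment> \<open>The cut-off turns the global integral in the weak type bound into one over the
      box and leaves the average over the box unchanged.\<close>
    define g where "g z = f z * indicator (Qbox I) z" for z
    have [measurable]: "g \<in> borel_measurable borel" unfolding g_def[abs_def] by measurable
    have g_eq: "ennreal (\<bar>g z\<bar> powr p * \<omega> z) = ennreal (\<bar>f z\<bar> powr p * \<omega> z) * indicator (Qbox I) z" for z
      by (auto simp: g_def indicator_def)
    have g_nonneg: "0 \<le> \<bar>g z\<bar> powr p * \<omega> z" for z
      using \<omega>(2)[of z] by (auto simp: g_def indicator_def)
    have integrable: "integrable (dV \<alpha>) (\<lambda>z. \<bar>g z\<bar> powr p * \<omega> z)"
      using False g_nonneg by (intro integrableI_nonneg) (auto simp: g_eq less_top infinity_ennreal_def)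
    have F_eq: "?F = ennreal (\<integral>z. \<bar>g z\<bar> powr p * \<omega> z \<partial>dV \<alpha>)"
      using nn_integral_eq_integral[OF integrable] g_nonneg by (simp add: g_eq)
    have "(\<integral>\<^sup>+z\<in>Qbox I. ennreal \<bar>g z\<bar> \<partial>dV \<alpha>) = (\<integral>\<^sup>+z\<in>Qbox I. ennreal \<bar>f z\<bar> \<partial>dV \<alpha>)"
      by (intro nn_integral_cong) (auto simp: g_def indicator_def)
    then have avg: "box_avg \<alpha> \<gamma> g I = box_avg \<alpha> \<gamma> f I" by (simp only: box_avg_def)
    have "epowr x q * emeasure \<mu> (Qbox I) \<le> ennreal C * epowr ?F (q / p)"
      if x: "x < box_avg \<alpha> \<gamma> f I" for x
    proof (cases "x = 0")
      case False
      obtain t where t: "x = ennreal t" "0 < t"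
        using x False by (cases x) (auto simp: less_le top_unique)
      have "Qbox I \<subseteq> {z \<in> UHP. ennreal t < Mfrac \<alpha> \<gamma> g z}"
        using Qbox_subset_UHP I x t avg by (auto simp: less_Mfrac_iff)
      then have "emeasure \<mu> (Qbox I) \<le> emeasure \<mu> {z \<in> UHP. ennreal t < Mfrac \<alpha> \<gamma> g z}"
        by (rule emeasure_mono) (simp add: assms open_superlevel_Mfrac)
      also have "\<dots> \<le> ennreal (C / t powr q * (\<integral>z. \<bar>g z\<bar> powr p * \<omega> z \<partial>dV \<alpha>) powr (q / p))"
        using integrable t by (intro a) auto
      also have "\<dots> = ennreal (C / t powr q) * epowr ?F (q / p)"
        unfolding F_eq using assms(6) g_nonneg
        by (subst epowr_ennreal) (auto simp: ennreal_mult[symmetric])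
      finally have "epowr x q * emeasure \<mu> (Qbox I)
          \<le> ennreal (t powr q) * (ennreal (C / t powr q) * epowr ?F (q / p))"
        unfolding t(1) epowr_ennreal[OF less_imp_le[OF t(2)]] by (rule mult_left_mono) simp
      also have "\<dots> = ennreal C * epowr ?F (q / p)"
        using t assms by (simp add: mult.assoc[symmetric] ennreal_mult[symmetric])
      finally show ?thesis .
    qed simp
    then have "(SUP x\<in>{..<box_avg \<alpha> \<gamma> f I}. epowr x q * emeasure \<mu> (Qbox I)) \<le> ennreal C * epowr ?F (q / p)"
      by (intro SUP_least) auto
    then have "epowr (SUP x\<in>{..<box_avg \<alpha> \<gamma> f I}. x) q * emeasure \<mu> (Qbox I) \<le> ennreal C * epowr ?F (q / p)"
      by (simp only: epowr_SUP[OF assms(2)] SUP_mult_right_ennreal)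
    then have "epowr (box_avg \<alpha> \<gamma> f I) q * emeasure \<mu> (Qbox I) \<le> ennreal C * epowr ?F (q / p)"
      by simp
    from mult_left_mono[OF this, of "ennreal (?k powr q)"] show ?thesis
      using assms k by (simp add: box_ineq_iff_avg epowr_mult epowr_ennreal ennreal_mult mult.assoc)
  qed
qed

text \<open>The box inequality is assumed for all Borel functions because a function with finite
  weighted integral need not be locally integrable. The factor
  \<open>3 powr (-(2 + \<alpha> - \<gamma>))\<close> is the loss from tripling an interval.\<close>

lemma weak_type_if_box_ineq:
  assumes pq: "1 \<le> p" "p \<le> q" and \<alpha>: "\<alpha> > -1" and "weight \<omega>" "sets \<mu> = sets borel" "0 < C"
    and c: "\<And>f I. f \<in> borel_measurable borel \<Longrightarrow> I \<in> intervals \<Longrightarrow> box_ineq p q \<alpha> \<gamma> \<omega> \<mu> C f I"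
    and [measurable]: "f \<in> borel_measurable borel"
    and integrable: "integrable (dV \<alpha>) (\<lambda>z. \<bar>f z\<bar> powr p * \<omega> z)"
    and t: "0 < t"
  shows "emeasure \<mu> {z \<in> UHP. ennreal t < Mfrac \<alpha> \<gamma> f z} \<le>
    ennreal (C / ((1 + \<alpha>) powr (1 - \<gamma> / (2 + \<alpha>)) * 3 powr (-(2 + \<alpha> - \<gamma>))) powr q / t powr q
      * (\<integral>z. \<bar>f z\<bar> powr p * \<omega> z \<partial>dV \<alpha>) powr (q / p))"
proof -
  let ?k = "(1 + \<alpha>) powr (1 - \<gamma> / (2 + \<alpha>)) * 3 powr (-(2 + \<alpha> - \<gamma>))"
  define F where "F A = (\<integral>\<^sup>+z\<in>A. ennreal (\<bar>f z\<bar> powr p * \<omega> z) \<partial>dV \<alpha>)" for A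
  define R where "R = ennreal (C / ?k powr q / t powr q)"
  have \<omega> [measurable]: "\<omega> \<in> borel_measurable borel"
    using assms(4) by (auto simp: weight_def loc_int_def)
  have k: "0 < ?k" using \<alpha> by simp
  have s: "1 \<le> q / p" using pq by simp
  \<comment> \<open>The weight is known to be nonnegative only on \<open>UHP\<close>, which carries
    all of \<open>dV \<alpha>\<close>.\<close>
  have nonneg: "AE z in dV \<alpha>. 0 \<le> \<bar>f z\<bar> powr p * \<omega> z"
    using AE_dV_UHP by eventually_elim (use assms(4) in \<open>auto simp: weight_def\<close>)
  have FUNIV: "F UNIV = ennreal (\<integral>z. \<bar>f z\<bar> powr p * \<omega> z \<partial>dV \<alpha>)"
    using nn_integral_eq_integral[OF integrable nonneg] by (simp add: F_def)
  \<comment> \<open>Cut off to the small box, \<open>f\<close> keeps its integral when the box is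
    tripled, so its average drops only by the length factor. The box inequality on the triple then
    has the integral over the small box on its right.\<close>
  have tripled: "emeasure \<mu> (Qbox {2 * a - b<..<2 * b - a}) \<le> R * epowr (F (Qbox {a<..<b})) (q / p)"
    if ab: "a < b" "ennreal t < box_avg \<alpha> \<gamma> f {a<..<b}" for a b
  proof -
    let ?I = "{a<..<b}" and ?J = "{2 * a - b<..<2 * b - a}"
    have J: "?J \<in> intervals" and I: "?I \<in> intervals" using ab by (auto intro!: greaterThanLessThan_intervals)
    note [measurable] = Qbox_borel[OF I]
    have sub: "Qbox ?I \<subseteq> Qbox ?J" using ab by (auto simp: Qbox_def)
    define g where "g z = f z * indicator (Qbox ?I) z" for z
    have [measurable]: "g \<in> borel_measurable borel" unfolding g_def[abs_def] by measurable
    have int_g: "(\<integral>\<^sup>+z\<in>Qbox ?J. ennreal \<bar>g z\<bar> \<partial>dV \<alpha>) = (\<integral>\<^sup>+z\<in>Qbox ?I. ennreal \<bar>f z\<bar> \<partial>dV \<alpha>)"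
      using sub by (intro nn_integral_cong) (auto simp: g_def indicator_def)
    have F_g: "(\<integral>\<^sup>+z\<in>Qbox ?J. ennreal (\<bar>g z\<bar> powr p * \<omega> z) \<partial>dV \<alpha>) = F (Qbox ?I)"
      unfolding F_def using sub by (intro nn_integral_cong) (auto simp: g_def indicator_def)
    have len: "ilen ?J = 3 * ilen ?I" using ab by simp
    have avg: "box_avg \<alpha> \<gamma> g ?J = ennreal (3 powr (-(2 + \<alpha> - \<gamma>))) * box_avg \<alpha> \<gamma> f ?I"
      using ab by (simp add: box_avg_def int_g len powr_mult ennreal_mult mult.assoc del: ilen_greaterThanLessThan)
    define m where "m = (?k * t) powr q"
    have m: "0 < m" using \<alpha> t by (simp add: m_def)
    have m_eq: "m = ?k powr q * t powr q" unfolding m_def by (rule powr_mult)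
    have "epowr (ennreal (?k * t)) q * emeasure \<mu> (Qbox ?J)
        \<le> epowr (ennreal ((1 + \<alpha>) powr (1 - \<gamma> / (2 + \<alpha>))) * box_avg \<alpha> \<gamma> g ?J) q * emeasure \<mu> (Qbox ?J)"
      unfolding avg using pq t ab(2)
      by (intro mult_right_mono epowr_mono)
         (auto simp: ennreal_mult mult.assoc intro!: mult_left_mono)
    also have "\<dots> \<le> ennreal C * epowr (F (Qbox ?I)) (q / p)"
      using c[of g ?J] J \<alpha> by (simp add: box_ineq_iff_avg F_g)
    finally have "ennreal m * emeasure \<mu> (Qbox ?J) \<le> ennreal C * epowr (F (Qbox ?I)) (q / p)"
      using k t by (simp add: epowr_ennreal m_def)
    then have "ennreal (1 / m) * (ennreal m * emeasure \<mu> (Qbox ?J))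
        \<le> ennreal (1 / m) * (ennreal C * epowr (F (Qbox ?I)) (q / p))"
      by (rule mult_left_mono) simp
    then have "ennreal (1 / m) * ennreal m * emeasure \<mu> (Qbox ?J)
        \<le> ennreal (1 / m) * ennreal C * epowr (F (Qbox ?I)) (q / p)"
      by (simp only: mult.assoc)
    moreover have "ennreal (1 / m) * ennreal m = 1" using m by (simp add: ennreal_mult[symmetric])
    moreover have "ennreal (1 / m) * ennreal C = R"
      using m assms(6) by (simp add: ennreal_mult[symmetric] R_def m_eq)
    ultimately show ?thesis by simp
  qed
  let ?P = "{(a, b). a < b \<and> ennreal t < box_avg \<alpha> \<gamma> f {a<..<b}}"
  let ?Q = "\<lambda>(a, b). Qbox {a<..<b}"
  have finite_le: "emeasure \<mu> (\<Union>x\<in>H. ?Q x) \<le> R * epowr (F UNIV) (q / p)" if H: "finite H" "H \<subseteq> ?P" for H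
  proof -
    obtain G where G: "G \<subseteq> H" "disjoint_family_on ?Q G"
      "(\<Union>x\<in>H. ?Q x) \<subseteq> (\<Union>(a, b)\<in>G. Qbox {2 * a - b<..<2 * b - a})"
      using H by (auto intro: Vitali_Qbox[of H])
    have fin: "finite G" using G H finite_subset by auto
    have ord: "a < b" if "(a, b) \<in> G" for a b using that G H by auto
    have Q3 [measurable]: "Qbox {2 * a - b<..<2 * b - a} \<in> sets \<mu>" for a b
      using open_Qbox assms(5) by simp
    have "emeasure \<mu> (\<Union>x\<in>H. ?Q x) \<le> emeasure \<mu> (\<Union>(a, b)\<in>G. Qbox {2 * a - b<..<2 * b - a})"
      using G(3) fin by (intro emeasure_mono) (auto intro!: sets.finite_UN)
    also have "\<dots> \<le> (\<Sum>(a, b)\<in>G. emeasure \<mu> (Qbox {2 * a - b<..<2 * b - a}))"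
      unfolding case_prod_beta' by (rule emeasure_subadditive_finite[OF fin]) auto
    also have "\<dots> \<le> (\<Sum>x\<in>G. R * epowr (F (?Q x)) (q / p))"
      using G H tripled by (intro sum_mono) auto
    also have "\<dots> = R * (\<Sum>x\<in>G. epowr (F (?Q x)) (q / p))" by (simp add: sum_distrib_left)
    \<comment> \<open>Here \<open>p \<le> q\<close> enters: the exponent \<open>q / p\<close> is at
      least 1, so superadditivity applies.\<close>
    also have "\<dots> \<le> R * epowr (\<Sum>x\<in>G. F (?Q x)) (q / p)"
      by (intro mult_left_mono epowr_sum_le s fin) simp
    \<comment> \<open>As the selected boxes are disjoint, their integrals add up to a single
      integral over the union.\<close>
    also have "(\<Sum>x\<in>G. F (?Q x)) \<le> F UNIV"
    proof -
      have [measurable]: "?Q x \<in> sets borel" for x using open_Qbox by (auto split: prod.split)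
      have "(\<Sum>x\<in>G. F (?Q x))
          = (\<integral>\<^sup>+z. (\<Sum>x\<in>G. ennreal (\<bar>f z\<bar> powr p * \<omega> z) * indicator (?Q x) z) \<partial>dV \<alpha>)"
        unfolding F_def by (rule nn_integral_sum[symmetric]) measurable
      also have "\<dots> = F (\<Union>x\<in>G. ?Q x)"
        unfolding F_def indicator_UN_disjoint[OF fin G(2)] sum_distrib_left ..
      also have "\<dots> \<le> F UNIV" unfolding F_def by (rule nn_set_integral_set_mono) simp
      finally show ?thesis .
    qed
    then have "R * epowr (\<Sum>x\<in>G. F (?Q x)) (q / p) \<le> R * epowr (F UNIV) (q / p)"
      using s by (intro mult_left_mono epowr_mono) auto
    finally show ?thesis .
  qed
  \<comment> \<open>The family of boxes need not be countable; Lindelof's theorem extracts a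
    countable subfamily with the same union, to which the finite bound extends.\<close>
  obtain \<A> where \<A>: "\<A> \<subseteq> ?Q ` ?P" "countable \<A>" "\<Union>\<A> = \<Union>(?Q ` ?P)"
    by (rule Lindelof[of "?Q ` ?P"]) (auto intro: open_Qbox)
  have "emeasure \<mu> (\<Union>\<A>) \<le> R * epowr (F UNIV) (q / p)"
  proof (rule emeasure_Union_le_finite[OF \<A>(2)])
    show "\<A> \<subseteq> sets \<mu>" using \<A>(1) open_Qbox by (auto simp: assms(5))
    fix \<F> assume "finite \<F>" "\<F> \<subseteq> \<A>"
    with \<A>(1) have "finite \<F>" "\<F> \<subseteq> ?Q ` ?P" by auto
    from finite_subset_image[OF this] obtain H where "H \<subseteq> ?P" "finite H" "\<F> = ?Q ` H"
      by (elim exE conjE)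
    then show "emeasure \<mu> (\<Union>\<F>) \<le> R * epowr (F UNIV) (q / p)" using finite_le[of H] by simp
  qed
  moreover have "(\<integral>z. \<bar>f z\<bar> powr p * \<omega> z \<partial>dV \<alpha>) \<ge> 0" using nonneg by (rule integral_nonneg_AE)
  ultimately show ?thesis
    unfolding superlevel_Mfrac \<A>(3) using assms(6)
    by (simp add: R_def FUNIV epowr_ennreal ennreal_mult[symmetric])
qed

theorem theorem2p3:
  fixes p q \<alpha> \<gamma> :: real and \<omega> :: "complex \<Rightarrow> real" and \<mu> :: "complex measure"
  assumes "1 \<le> p" and "p \<le> q" and "\<alpha> > -1" and "0 \<le> \<gamma>" and "\<gamma> < 2 + \<alpha>"
    and "weight \<omega>" and "sets \<mu> = sets borel"
  shows
   "((\<exists>C1>0. \<forall>f. f \<in> borel_measurable borel \<and> integrable (dV \<alpha>) (\<lambda>z. \<bar>f z\<bar> powr p * \<omega> z) \<longrightarrow>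
        (\<forall>t>0. emeasure \<mu> {z \<in> UHP. Mfrac \<alpha> \<gamma> f z > ennreal t}
           \<le> ennreal (C1 / t powr q * (\<integral>z. \<bar>f z\<bar> powr p * \<omega> z \<partial>dV \<alpha>) powr (q / p))))
     \<longleftrightarrow>
     (\<exists>C2>0. \<forall>I \<in> intervals. bfactor p q \<alpha> \<gamma> \<omega> I * emeasure \<mu> (Qbox I) \<le> ennreal C2))
   \<and>
   ((\<exists>C2>0. \<forall>I \<in> intervals. bfactor p q \<alpha> \<gamma> \<omega> I * emeasure \<mu> (Qbox I) \<le> ennreal C2)
     \<longleftrightarrow>
     (\<exists>C3>0. \<forall>f. loc_int f \<longrightarrow> (\<forall>I \<in> intervals.
        epowr (ennreal (Qvol \<alpha> I powr (-(1 - \<gamma> / (2 + \<alpha>)))) * (\<integral>\<^sup>+ z\<in>Qbox I. ennreal \<bar>f z\<bar> \<partial>dV \<alpha>)) q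
          * emeasure \<mu> (Qbox I)
        \<le> ennreal C3 * epowr (\<integral>\<^sup>+ z\<in>Qbox I. ennreal (\<bar>f z\<bar> powr p * \<omega> z) \<partial>dV \<alpha>) (q / p))))"
  (is "(?A \<longleftrightarrow> ?B) \<and> (?B \<longleftrightarrow> ?C)")
proof -
  have q: "0 < q" using assms by simp
  \<comment> \<open>From (b) the box inequality follows for every Borel function, whereas (c) gives
    it only for locally integrable ones. The weak type bound uses the former, so (c) reaches (a)
    through (b).\<close>
  have strong: "box_ineq p q \<alpha> \<gamma> \<omega> \<mu> C f I"
    if "\<forall>I\<in>intervals. bfactor p q \<alpha> \<gamma> \<omega> I * emeasure \<mu> (Qbox I) \<le> ennreal C"
      "f \<in> borel_measurable borel" "I \<in> intervals" for C f I
    using box_ineq_if_bfactor[OF assms(1) q assms(3,6)] that by blast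
  have "?B" if "?C"
  proof -
    from that obtain C where C: "0 < C" "\<And>f I. loc_int f \<Longrightarrow> I \<in> intervals \<Longrightarrow> box_ineq p q \<alpha> \<gamma> \<omega> \<mu> C f I"
      unfolding box_ineq_def by auto
    show ?B using bfactor_le_if_box_ineq[OF assms(1) q assms(3,6)] C by blast
  qed
  moreover have "?C" if "?B"
  proof -
    from that obtain C where C: "0 < C"
      "\<forall>I\<in>intervals. bfactor p q \<alpha> \<gamma> \<omega> I * emeasure \<mu> (Qbox I) \<le> ennreal C" by blast
    have "f \<in> borel_measurable borel" if "loc_int f" for f using that by (simp add: loc_int_def)
    then show ?C unfolding box_ineq_def[symmetric] using C strong by blast
  qed
  moreover have "?A" if "?B"
  proof -
    let ?k = "((1 + \<alpha>) powr (1 - \<gamma> / (2 + \<alpha>)) * 3 powr (-(2 + \<alpha> - \<gamma>))) powr q"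
    from that obtain C where C: "0 < C"
      "\<forall>I\<in>intervals. bfactor p q \<alpha> \<gamma> \<omega> I * emeasure \<mu> (Qbox I) \<le> ennreal C" by blast
    have "0 < C / ?k" using C assms(3) by simp
    then show ?A
      using weak_type_if_box_ineq[OF assms(1-3,6,7) C(1) strong[OF C(2)]]
      by (intro exI[of _ "C / ?k"] conjI allI impI) auto
  qed
  moreover have "?B" if "?A"
  proof -
    from that obtain C where C: "0 < C" and
      a: "\<And>g t. g \<in> borel_measurable borel \<Longrightarrow> integrable (dV \<alpha>) (\<lambda>z. \<bar>g z\<bar> powr p * \<omega> z) \<Longrightarrow>
        0 < t \<Longrightarrow> emeasure \<mu> {z \<in> UHP. ennreal t < Mfrac \<alpha> \<gamma> g z}
          \<le> ennreal (C / t powr q * (\<integral>z. \<bar>g z\<bar> powr p * \<omega> z \<partial>dV \<alpha>) powr (q / p))"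
      by auto
    let ?C = "((1 + \<alpha>) powr (1 - \<gamma> / (2 + \<alpha>))) powr q * C"
    have "0 < ?C" using C assms(3) by simp
    moreover have "box_ineq p q \<alpha> \<gamma> \<omega> \<mu> ?C f I" if "loc_int f" "I \<in> intervals" for f I
    proof (rule box_ineq_if_weak_type[OF assms(1) q assms(3,6,7) C that(2) _ a])
      show "f \<in> borel_measurable borel" using that(1) by (simp add: loc_int_def)
    qed
    ultimately show ?B using bfactor_le_if_box_ineq[OF assms(1) q assms(3,6)] by blast
  qed
  ultimately show ?thesis by blast
qed

end
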